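(* For every integer $r\ge 4$ there exists a real $c_r>0$ such that for every integer $n\ge 4$ there is a linear $r$-uniform hypergraph $\mathcal F$ on $n$ vertices which contains no $r\times r$ grid and satisfies $$|\mathcal F| > \frac{n(n-1)}{r(r-1)}-c_r n^{8/5}.$$
   Context: A hypergraph is identified with its set of edges $\mathcal F$ (a set of subsets of a finite vertex set). It is $r$-uniform if every edge has exactly $r$ elements, and linear if $|A\cap B|\le 1$ for all distinct edges $A,B$. An $r$-uniform hypergraph contains an $r\times r$ grid if it has $2r$ distinct edges $A_1,\dots,A_r,B_1,\dots,B_r$ with $A_i\cap A_j=B_i\cap B_j=\emptyset$ for $1\le i<j\le r$ and $|A_i\cap B_j|=1$ for all $1\le i,j\le r$. *)

theory Defs
  imports Complex_Main
begin

definition hypergraph_on :: "'a set \<Rightarrow> 'a set set \<Rightarrow> bool" where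
  "hypergraph_on V F \<longleftrightarrow> finite V \<and> (\<forall>e\<in>F. e \<subseteq> V)"

definition uniform_hypergraph :: "nat \<Rightarrow> 'a set set \<Rightarrow> bool" where
  "uniform_hypergraph r F \<longleftrightarrow> (\<forall>e\<in>F. finite e \<and> card e = r)"

text \<open>Edges are subsets of a finite vertex set, so \<open>card\<close> is only ever applied to finite sets here.\<close>
definition linear_hypergraph :: "'a set set \<Rightarrow> bool" where
  "linear_hypergraph F \<longleftrightarrow> (\<forall>A\<in>F. \<forall>B\<in>F. A \<noteq> B \<longrightarrow> card (A \<inter> B) \<le> 1)"

text \<open>The two injectivity conditions and the disjointness of the images say that the
  \<open>2 * r\<close> edges are pairwise distinct.\<close>
definition contains_grid :: "nat \<Rightarrow> 'a set set \<Rightarrow> bool" where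
  "contains_grid r F \<longleftrightarrow>
    (\<exists>A B :: nat \<Rightarrow> 'a set.
      A ` {1..r} \<subseteq> F \<and> B ` {1..r} \<subseteq> F \<and>
      inj_on A {1..r} \<and> inj_on B {1..r} \<and> A ` {1..r} \<inter> B ` {1..r} = {} \<and>
      (\<forall>i j. 1 \<le> i \<and> i < j \<and> j \<le> r \<longrightarrow> A i \<inter> A j = {} \<and> B i \<inter> B j = {}) \<and>
      (\<forall>i\<in>{1..r}. \<forall>j\<in>{1..r}. card (A i \<inter> B j) = 1))"

end

theory Submission
  imports Defs "HOL-Number_Theory.Cong" "HOL-Combinatorics.Permutations" "HOL-Library.FuncSet"
begin

text \<open>The number \<open>n (n - 1) / (r (r - 1))\<close> is reached, up to lower order terms, by a recursive construction. Split the vertices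
  into \<open>r\<close> columns, each a copy of the residues modulo \<open>m\<close>. Take as edges the \<open>m\<^sup>2\<close> lines \<open>{(k, a x\<^sub>k + b) | k < r}\<close>,
  where \<open>x\<^sub>0, \<dots>, x\<^bsub>r-1\<^esub>\<close> are fixed integers whose differences are units modulo \<open>m\<close>. They cover every pair of vertices
  from different columns exactly once. Then fill each column with a hypergraph of the same kind on \<open>m\<close> vertices. The leading
  terms agree, since \<open>m\<^sup>2 + r \<cdot> m (m - 1) / (r (r - 1)) = r m (r m - 1) / (r (r - 1))\<close>.

  A grid consisting of lines only defines a Latin square, with the column of the crossing point of \<open>A\<^sub>i\<close> and \<open>B\<^sub>j\<close>
  as entry, and a solution of a homogeneous linear system for the slopes and intercepts. The integers
  \<open>x\<^sub>k\<close> are chosen such that, for every Latin square of order \<open>r \<ge> 4\<close>, all lines of a solution coincide. Over the integers this is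
  proved by descent modulo a prime: if some \<open>x\<^sub>k\<close> are 0 and the others are 1 modulo \<open>p\<close>, the former identify intercepts and the
  latter identify sums of slope and intercept along the edges of a bipartite graph of rows and columns, and a combinatorial study of Latin squares
  (\<open>half_split\<close>, \<open>odd_split\<close>) gives enough connectedness (\<open>generic_directions\<close>). Elimination transfers the result to all moduli
  coprime to a constant (\<open>generic_directions_mod\<close>). Such moduli have bounded gaps, so that rounding \<open>n\<close> costs
  only \<open>O(n)\<close> edges.

  A grid that mixes lines with edges inside columns has one of two shapes (\<open>matrix_cases\<close>): either one class
  has one edge inside each column and the other consists of lines, or each class has exactly one edge inside a column, the
  same column for both. If the hypergraphs in the columns are relabelled by random permutations, the expected number of
  such configurations is \<open>O(m)\<close>, so \<open>O(m)\<close> edges can be deleted to destroy them (\<open>few_bad_edges\<close>, \<open>combined_gridfree\<close>). Solving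
  the recursion gives an error of order \<open>n sqrt n\<close>, which is below \<open>n powr (8 / 5)\<close> (\<open>packing_bound\<close>).\<close>

section \<open>Connected sets of symbols in Latin squares\<close>

lemma ex_two:
  assumes "finite A" "2 \<le> card A"
  shows "\<exists>x\<in>A. \<exists>y\<in>A. x \<noteq> y"
  using assms card_le_Suc0_iff_eq[of A] by fastforce

locale latin_square =
  fixes r :: nat and L :: "nat \<Rightarrow> nat \<Rightarrow> nat"
  assumes entry: "\<lbrakk>i < r; j < r\<rbrakk> \<Longrightarrow> L i j < r"
    and row_inj: "i < r \<Longrightarrow> inj_on (L i) {..<r}"
    and column_inj: "j < r \<Longrightarrow> inj_on (\<lambda>i. L i j) {..<r}"
begin

definition closed_under :: "nat set \<Rightarrow> nat set \<Rightarrow> nat set \<Rightarrow> bool" where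
  "closed_under S R C \<longleftrightarrow> R \<subseteq> {..<r} \<and> C \<subseteq> {..<r} \<and>
     (\<forall>i<r. \<forall>j<r. L i j \<in> S \<longrightarrow> (i \<in> R \<longleftrightarrow> j \<in> C))"

text \<open>Join row \<open>i\<close> to column \<open>j\<close> whenever the entry \<open>L i j\<close> lies in \<open>S\<close>. In this bipartite graph
  \<^const>\<open>closed_under\<close> describes the unions of connected components, and the next definition says
  that the graph is connected.\<close>

definition connects :: "nat set \<Rightarrow> bool" where
  "connects S \<longleftrightarrow> (\<forall>R C. closed_under S R C \<longrightarrow>
     R = {} \<and> C = {} \<or> R = {..<r} \<and> C = {..<r})"

definition cell :: "nat \<Rightarrow> nat \<Rightarrow> nat" where
  "cell k i = inv_into {..<r} (L i) k"

lemma row_surj: assumes "i < r" shows "L i ` {..<r} = {..<r}"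
  using assms entry row_inj by (intro endo_inj_surj) auto

lemma cell_props:
  assumes "i < r" "k < r"
  shows "cell k i < r" "L i (cell k i) = k"
proof -
  have k: "k \<in> L i ` {..<r}" using row_surj assms by auto
  show "cell k i < r" using inv_into_into[OF k] by (simp add: cell_def)
  show "L i (cell k i) = k" using f_inv_into_f[OF k] by (simp add: cell_def)
qed

lemma cell_bij: assumes "k < r" shows "bij_betw (cell k) {..<r} {..<r}"
proof -
  have inj: "inj_on (cell k) {..<r}"
  proof (rule inj_onI)
    fix i i' assume h: "i \<in> {..<r}" "i' \<in> {..<r}" "cell k i = cell k i'"
    then have "L i (cell k i) = L i' (cell k i)"
      using cell_props[of i k] cell_props[of i' k] assms by auto
    then show "i = i'"
      using column_inj[of "cell k i"] h cell_props[of i k] assms by (auto simp: inj_on_def)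
  qed
  moreover have "cell k ` {..<r} = {..<r}"
    using inj cell_props assms by (intro endo_inj_surj) auto
  ultimately show ?thesis by (simp add: bij_betw_def)
qed

lemma closed_under_complement:
  "closed_under S R C \<Longrightarrow> closed_under S ({..<r} - R) ({..<r} - C)"
  by (auto simp: closed_under_def)

text \<open>Each symbol of \<open>S\<close> is a perfect matching of the graph, and so matches the two sides of every
  union of components. This is the source of all the counting and of all the sums below.\<close>

lemma closed_under_bij:
  assumes "closed_under S R C" "k \<in> S" "k < r"
  shows "bij_betw (cell k) R C"
proof -
  have R: "R \<subseteq> {..<r}" "C \<subseteq> {..<r}"
    and cl: "\<And>i j. \<lbrakk>i < r; j < r; L i j \<in> S\<rbrakk> \<Longrightarrow> (i \<in> R \<longleftrightarrow> j \<in> C)"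
    using assms(1) by (auto simp: closed_under_def)
  have "cell k ` R = C"
  proof (intro equalityI subsetI)
    fix j assume "j \<in> cell k ` R"
    then obtain i where i: "i \<in> R" "j = cell k i" by auto
    then show "j \<in> C" using cl[of i j] cell_props[of i k] R assms by auto
  next
    fix j assume j: "j \<in> C"
    then obtain i where i: "i < r" "j = cell k i"
      using cell_bij[OF assms(3)] R unfolding bij_betw_def by (metis imageE lessThan_iff subsetD)
    then show "j \<in> cell k ` R" using cl[of i j] cell_props[of i k] j assms by auto
  qed
  then show ?thesis using cell_bij[OF assms(3)] R
    by (auto simp: bij_betw_def intro: inj_on_subset)
qed

lemma closed_under_card:
  assumes "closed_under S R C" "S \<subseteq> {..<r}" "S \<noteq> {}"
  shows "card R = card C"
proof -
  obtain k where "k \<in> S" "k < r" using assms by auto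
  then show ?thesis using closed_under_bij[OF assms(1)] by (metis bij_betw_same_card)
qed

lemma row_cells:
  assumes "closed_under S R C" "S \<subseteq> {..<r}" "i \<in> R"
  shows "(\<lambda>k. cell k i) ` S \<subseteq> C" "card ((\<lambda>k. cell k i) ` S) = card S"
proof -
  have i: "i < r" using assms by (auto simp: closed_under_def)
  show "(\<lambda>k. cell k i) ` S \<subseteq> C"
  proof
    fix j assume "j \<in> (\<lambda>k. cell k i) ` S"
    then obtain k where k: "k \<in> S" "j = cell k i" by auto
    then show "j \<in> C" using cell_props[of i k] assms i by (auto simp: closed_under_def)
  qed
  have "inj_on (\<lambda>k. cell k i) S"
    by (rule inj_on_inverseI[of _ "L i"]) (use i cell_props(2) assms(2) in auto)
  then show "card ((\<lambda>k. cell k i) ` S) = card S" by (rule card_image)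
qed

lemma closed_under_card_ge:
  assumes "closed_under S R C" "S \<subseteq> {..<r}" "R \<noteq> {}"
  shows "card S \<le> card C"
proof -
  obtain i where i: "i \<in> R" using assms by auto
  have "finite C" using assms(1) finite_subset by (auto simp: closed_under_def)
  then show ?thesis using row_cells[OF assms(1,2) i] card_mono by metis
qed

text \<open>A row of \<open>R\<close> already needs \<open>card S\<close> different columns of \<open>C\<close> for its symbols in \<open>S\<close>.\<close>

lemma block_full:
  assumes "closed_under S R C" "S \<subseteq> {..<r}" "card C = card S" "i \<in> R" "j \<in> C"
  shows "L i j \<in> S"
proof -
  have "finite C" using assms(1) finite_subset by (auto simp: closed_under_def)
  then have "(\<lambda>k. cell k i) ` S = C"
    using row_cells[OF assms(1,2,4)] assms(3) card_subset_eq by metis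
  then obtain k where "k \<in> S" "j = cell k i" using assms(5) by auto
  moreover have "i < r" using assms(1,4) by (auto simp: closed_under_def)
  ultimately show ?thesis using cell_props[of i k] assms(2) by auto
qed

lemma not_connectsE:
  assumes "\<not> connects S" "S \<subseteq> {..<r}" "S \<noteq> {}"
  obtains R C where "closed_under S R C" "card R = card C"
    "card S \<le> card C" "card C + card S \<le> r"
proof -
  obtain R C where cl: "closed_under S R C"
    and n: "\<not> (R = {} \<and> C = {})" "\<not> (R = {..<r} \<and> C = {..<r})"
    using assms by (auto simp: connects_def)
  have sub: "R \<subseteq> {..<r}" "C \<subseteq> {..<r}" using cl by (auto simp: closed_under_def)
  then have fin: "finite R" "finite C" using finite_subset by auto
  have eq: "card R = card C" using closed_under_card[OF cl assms(2,3)] .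
  have R: "R \<noteq> {}" using n(1) eq fin by auto
  have "R \<noteq> {..<r}"
  proof
    assume "R = {..<r}"
    then have "C = {..<r}" using eq sub(2) by (intro card_subset_eq) auto
    then show False using n \<open>R = {..<r}\<close> by auto
  qed
  then have R': "{..<r} - R \<noteq> {}" using sub by auto
  have "card S \<le> card ({..<r} - C)"
    using closed_under_card_ge[OF closed_under_complement[OF cl] assms(2) R'] .
  also have "\<dots> = r - card C" using sub fin by (simp add: card_Diff_subset)
  finally have "card S \<le> r - card C" .
  moreover have "card C \<le> r" using card_mono[OF _ sub(2)] by simp
  ultimately have "card C + card S \<le> r" by linarith
  then show ?thesis using that cl eq closed_under_card_ge[OF cl assms(2) R] by blast
qed

lemma connects_large:
  assumes "S \<subseteq> {..<r}" "r < 2 * card S"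
  shows "connects S"
proof (rule ccontr)
  assume "\<not> connects S"
  moreover have "S \<noteq> {}" using assms by auto
  ultimately obtain R C where "closed_under S R C" "card S \<le> card C" "card C + card S \<le> r"
    using not_connectsE[OF _ assms(1)] by blast
  then show False using assms(2) by linarith
qed

lemma connects_const:
  assumes "connects S" "i < r" "j < r"
    and eq: "\<And>i j. \<lbrakk>i < r; j < r; L i j \<in> S\<rbrakk> \<Longrightarrow> f i = g j"
  shows "f i = g j"
proof -
  let ?R = "{i'. i' < r \<and> f i' = f i}" and ?C = "{j'. j' < r \<and> g j' = f i}"
  have "closed_under S ?R ?C" using eq by (auto simp: closed_under_def)
  then have "?R = {} \<and> ?C = {} \<or> ?R = {..<r} \<and> ?C = {..<r}"
    using assms(1) unfolding connects_def by blast
  moreover have "i \<in> ?R" using assms by simp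
  ultimately have "?C = {..<r}" by blast
  then have "j \<in> ?C" using assms(3) by blast
  then show ?thesis by simp
qed

text \<open>The graph of \<open>S\<close> is \<open>s\<close>-regular on \<open>2s + 2s\<close> vertices, so a proper union of components has exactly
  \<open>s\<close> rows and \<open>s\<close> columns and is complete. The square is then a two by two array of
  subsquares, alternately with symbols in \<open>S\<close> and in the complement of \<open>S\<close>.\<close>

lemma half_split:
  assumes "r = 2 * s" "0 < s" "S \<subseteq> {..<r}" "card S = s"
  obtains "connects S" "connects ({..<r} - S)"
  | R C where "closed_under S R C" "card R = s" "card C = s"
      "\<And>i j. i \<in> R \<Longrightarrow> j \<in> C \<Longrightarrow> L i j \<in> S"
      "\<And>i j. i \<in> {..<r} - R \<Longrightarrow> j \<in> {..<r} - C \<Longrightarrow> L i j \<in> S"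
      "closed_under ({..<r} - S) R ({..<r} - C)"
      "\<And>i j. i \<in> R \<Longrightarrow> j \<in> {..<r} - C \<Longrightarrow> L i j \<in> {..<r} - S"
      "\<And>i j. i \<in> {..<r} - R \<Longrightarrow> j \<in> C \<Longrightarrow> L i j \<in> {..<r} - S"
proof -
  have block: "\<exists>R C. closed_under T R C \<and> card R = s \<and> card C = s \<and>
      (\<forall>i\<in>R. \<forall>j\<in>C. L i j \<in> T) \<and> (\<forall>i\<in>{..<r} - R. \<forall>j\<in>{..<r} - C. L i j \<in> T) \<and>
      closed_under ({..<r} - T) R ({..<r} - C)"
    if T: "T \<subseteq> {..<r}" "card T = s" "\<not> connects T" for T
  proof -
    have ne: "T \<noteq> {}" using T assms by auto
    obtain R C where cl: "closed_under T R C" and c: "card R = card C"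
      "card T \<le> card C" "card C + card T \<le> r"
      using not_connectsE[OF T(3,1) ne] by blast
    then have cC: "card C = s" "card R = s" using T assms by auto
    have sub: "R \<subseteq> {..<r}" "C \<subseteq> {..<r}" using cl by (auto simp: closed_under_def)
    have cC': "card ({..<r} - C) = card T"
      using cC sub T assms by (simp add: card_Diff_subset finite_subset)
    have full: "\<And>i j. i \<in> R \<Longrightarrow> j \<in> C \<Longrightarrow> L i j \<in> T"
      using block_full[OF cl T(1)] cC T by auto
    have full': "\<And>i j. i \<in> {..<r} - R \<Longrightarrow> j \<in> {..<r} - C \<Longrightarrow> L i j \<in> T"
      using block_full[OF closed_under_complement[OF cl] T(1) cC'] .
    have "closed_under ({..<r} - T) R ({..<r} - C)"
      using sub full full' unfolding closed_under_def by blast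
    then show ?thesis using cl cC full full' by blast
  qed
  show thesis
  proof (cases "connects S")
    case False
    then obtain R C where h: "closed_under S R C" "card R = s" "card C = s"
        "\<forall>i\<in>R. \<forall>j\<in>C. L i j \<in> S" "\<forall>i\<in>{..<r} - R. \<forall>j\<in>{..<r} - C. L i j \<in> S"
        "closed_under ({..<r} - S) R ({..<r} - C)"
      using block[OF assms(3,4)] by blast
    have "\<And>i j. i \<in> R \<Longrightarrow> j \<in> {..<r} - C \<Longrightarrow> L i j \<in> {..<r} - S"
         "\<And>i j. i \<in> {..<r} - R \<Longrightarrow> j \<in> C \<Longrightarrow> L i j \<in> {..<r} - S"
      using h(1) entry unfolding closed_under_def by (metis Diff_iff lessThan_iff subsetD)+
    then show ?thesis using that(2) h by blast
  next
    case True
    show ?thesis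
    proof (cases "connects ({..<r} - S)")
      case False
      have "card ({..<r} - S) = s" using assms by (simp add: card_Diff_subset finite_subset)
      then obtain R C where h: "card R = s" "card C = s"
          "closed_under ({..<r} - ({..<r} - S)) R ({..<r} - C)"
        using block[OF _ _ False] by blast
      have "{..<r} - ({..<r} - S) = S" using assms(3) by auto
      then have "closed_under S R ({..<r} - C)" using h by simp
      then have "R = {} \<or> R = {..<r}" using True unfolding connects_def by blast
      then have "card R = 0 \<or> card R = r" by auto
      then show ?thesis using h(1) assms by auto
    qed (use True that(1) in blast)
  qed
qed

text \<open>A set of \<open>s + 1\<close> symbols is connected because its components would be too large. So both
  cuts can fail only if \<open>S = {..<s}\<close> and the set \<open>T\<close> of the last \<open>s\<close> symbols are both disconnected. In that case \<open>S\<close>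
  fills an \<open>s\<close> by \<open>s\<close> block \<open>R \<times> C\<close>. The \<open>T\<close>-entries of the rows of \<open>R\<close> lie in the \<open>s + 1\<close> columns outside \<open>C\<close>,
  which forces \<open>R\<close> and all these columns into one component of \<open>T\<close>. That component contains one more row, and in
  this row every entry over \<open>C\<close> must be the only symbol left, \<open>s\<close>: a repetition.\<close>

lemma odd_split:
  assumes r: "r = 2 * s + 1" and s: "2 \<le> s"
  obtains "connects {..<s}" "connects ({..<r} - {..<s})"
  | "connects {..<Suc s}" "connects ({..<r} - {..<Suc s})"
proof -
  have b1: "connects ({..<r} - {..<s})" using r by (intro connects_large) auto
  have b2: "connects {..<Suc s}" using r by (intro connects_large) auto
  define S where "S = {..<s}"
  define T where "T = {..<r} - {..<Suc s}"
  have S: "S \<subseteq> {..<r}" "card S = s" "S \<noteq> {}" using r s by (auto simp: S_def lessThan_empty_iff)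
  have T: "T \<subseteq> {..<r}" "card T = s" "T \<noteq> {}"
    using r s by (auto simp: T_def lessThan_Suc_atMost lessThan_atLeast0 card_Diff_subset)
  have ST: "k \<in> S \<or> k = s \<or> k \<in> T" if "k < r" for k using that by (auto simp: S_def T_def)
  have disj: "S \<inter> T = {}" by (auto simp: S_def T_def)
  have "connects T" if nS: "\<not> connects S"
  proof (rule ccontr)
    assume nT: "\<not> connects T"
    obtain R0 C0 where cl0: "closed_under S R0 C0" and c0: "card R0 = card C0"
      "card S \<le> card C0" "card C0 + card S \<le> r"
      using not_connectsE[OF nS S(1,3)] by blast
    have "\<exists>R C. closed_under S R C \<and> card R = s \<and> card C = s"
    proof (cases "card C0 = s")
      case True then show ?thesis using cl0 c0 by auto
    next
      case False
      then have c: "card C0 = s + 1" using c0 S r by auto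
      have "R0 \<subseteq> {..<r}" "C0 \<subseteq> {..<r}" using cl0 by (auto simp: closed_under_def)
      then have "card ({..<r} - R0) = s" "card ({..<r} - C0) = s"
        using c c0 r by (simp_all add: card_Diff_subset finite_subset)
      then show ?thesis using closed_under_complement[OF cl0] by blast
    qed
    then obtain R C where cl: "closed_under S R C" and c: "card R = s" "card C = s" by blast
    have sub: "R \<subseteq> {..<r}" "C \<subseteq> {..<r}" using cl by (auto simp: closed_under_def)
    then have fin: "finite R" "finite C" using finite_subset by auto
    have cC': "card ({..<r} - C) = s + 1" using c r sub fin by (simp add: card_Diff_subset)
    have full: "L i j \<in> S" if "i \<in> R" "j \<in> C" for i j
      using block_full[OF cl S(1)] c S that by auto
    have notS: "L i j \<in> T \<or> L i j = s" if "i \<in> R" "j \<in> {..<r} - C" for i j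
      using cl that ST[of "L i j"] entry[of i j] sub unfolding closed_under_def by blast
    obtain R1 C1 where cl1: "closed_under T R1 C1" and c1: "card R1 = card C1"
        "card T \<le> card C1" "card C1 + card T \<le> r"
      using not_connectsE[OF nT T(1,3)] by blast
    have sub1: "R1 \<subseteq> {..<r}" "C1 \<subseteq> {..<r}" using cl1 by (auto simp: closed_under_def)
    have iff1: "i \<in> R1 \<longleftrightarrow> j \<in> C1" if "i < r" "j < r" "L i j \<in> T" for i j
      using cl1 that by (auto simp: closed_under_def)
    have same: "i \<in> R1 \<longleftrightarrow> i' \<in> R1" if ii: "i \<in> R" "i' \<in> R" for i i'
    proof -
      let ?A = "(\<lambda>k. cell k i) ` T" and ?B = "(\<lambda>k. cell k i') ` T"
      have lt: "i < r" "i' < r" using ii sub by auto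
      have in_C': "(\<lambda>k. cell k l) ` T \<subseteq> {..<r} - C" if l: "l \<in> R" for l
      proof
        fix j assume "j \<in> (\<lambda>k. cell k l) ` T"
        then obtain k where k: "k \<in> T" "j = cell k l" by auto
        have "l < r" "k < r" using l sub k T(1) by auto
        then have "j < r" "L l j \<in> T" using cell_props[of l k] k by auto
        then show "j \<in> {..<r} - C" using full[OF l, of j] disj by auto
      qed
      have inj: "card ((\<lambda>k. cell k l) ` T) = s" if l: "l < r" for l
      proof -
        have "inj_on (\<lambda>k. cell k l) T"
          by (rule inj_on_inverseI[of _ "L l"]) (use l cell_props(2) T(1) in auto)
        then show ?thesis using T(2) by (simp add: card_image)
      qed
      have "?A \<inter> ?B \<noteq> {}"
      proof
        assume e: "?A \<inter> ?B = {}"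
        have fT: "finite T" by (simp add: T_def)
        have "card ?A + card ?B = card (?A \<union> ?B)"
          using e fT by (subst card_Un_disjoint) auto
        also have "\<dots> \<le> card ({..<r} - C)" using in_C' ii by (intro card_mono) auto
        finally show False using inj lt cC' s by auto
      qed
      then obtain k k' where k: "k \<in> T" "k' \<in> T" "cell k i = cell k' i'" by auto
      then have "L i (cell k i) \<in> T" "L i' (cell k i) \<in> T" "cell k i < r"
        using cell_props[of i k] cell_props[of i' k'] lt T(1) by auto
      then show ?thesis using iff1 lt by metis
    qed
    have hit: "\<exists>i\<in>R. L i j \<in> T" if j: "j \<in> {..<r} - C" for j
    proof -
      obtain i i' where i: "i \<in> R" "i' \<in> R" "i \<noteq> i'"
        using c s by (metis ex_two fin(1))
      then have "L i j \<noteq> L i' j" using column_inj[of j] j sub by (auto simp: inj_on_def)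
      then show ?thesis using notS i j by metis
    qed
    have "R \<noteq> {}" using c s by auto
    then have "(R \<subseteq> R1 \<and> {..<r} - C \<subseteq> C1) \<or> (R \<subseteq> {..<r} - R1 \<and> {..<r} - C \<subseteq> {..<r} - C1)"
    proof -
      have h: "j \<in> C1 \<longleftrightarrow> R \<subseteq> R1" if j: "j \<in> {..<r} - C" for j
      proof -
        obtain i where i: "i \<in> R" "L i j \<in> T" using hit[OF j] by auto
        then have "i \<in> R1 \<longleftrightarrow> j \<in> C1" using iff1[of i j] j sub by auto
        then show ?thesis using same i by blast
      qed
      have "R \<subseteq> R1 \<or> R \<subseteq> {..<r} - R1" using same sub by blast
      then show ?thesis
      proof
        assume "R \<subseteq> R1" then show ?thesis using h by blast
      next
        assume a: "R \<subseteq> {..<r} - R1"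
        then have "\<not> R \<subseteq> R1" using \<open>R \<noteq> {}\<close> by blast
        then show ?thesis using h a by blast
      qed
    qed
    then obtain R2 C2 where cl2: "closed_under T R2 C2" and in2: "R \<subseteq> R2" "{..<r} - C \<subseteq> C2"
        and c2: "card R2 = card C2" "card C2 \<le> s + 1"
    proof
      assume "R \<subseteq> R1 \<and> {..<r} - C \<subseteq> C1"
      then show ?thesis using that[of R1 C1] cl1 c1 T r by auto
    next
      assume "R \<subseteq> {..<r} - R1 \<and> {..<r} - C \<subseteq> {..<r} - C1"
      then show ?thesis using that[of "{..<r} - R1" "{..<r} - C1"] closed_under_complement[OF cl1]
          c1 T r sub1 by (simp add: card_Diff_subset finite_subset)
    qed
    have sub2: "R2 \<subseteq> {..<r}" "C2 \<subseteq> {..<r}" using cl2 by (auto simp: closed_under_def)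
    have C2: "{..<r} - C = C2"
      using in2 c2 cC' sub2 by (intro card_seteq) (auto intro: finite_subset)
    then have "card R2 = s + 1" using c2 cC' by simp
    then obtain i0 where i0: "i0 \<in> R2" "i0 \<notin> R" using c in2 card_mono[OF fin(1), of R2] by fastforce
    have "L i0 j = s" if j: "j \<in> C" for j
    proof -
      have lt: "i0 < r" "j < r" using i0 j sub sub2 by auto
      then have "L i0 j \<notin> S" using cl i0 j by (auto simp: closed_under_def)
      moreover have "L i0 j \<notin> T" using cl2 i0 j C2 lt unfolding closed_under_def by blast
      ultimately show ?thesis using ST[of "L i0 j"] entry[OF lt] by blast
    qed
    moreover obtain j j' where "j \<in> C" "j' \<in> C" "j \<noteq> j'"
      using c s by (metis ex_two fin(2))
    moreover have "i0 < r" using i0 sub2 by auto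
    ultimately show False using row_inj[of i0] sub unfolding inj_on_def by (metis subsetD)
  qed
  then show ?thesis using b1 b2 that unfolding S_def T_def by blast
qed

end

section \<open>Abscissas that admit only trivial Latin systems\<close>

context latin_square
begin

text \<open>Row \<open>i\<close> stands for the line \<open>y = a\<^sub>i x + b\<^sub>i\<close> and column \<open>j\<close> for \<open>y = \<alpha>\<^sub>j x + \<beta>\<^sub>j\<close>. The equations say that these two
  lines meet at the abscissa \<open>x k\<close>, where \<open>k\<close> is the entry of the Latin square.\<close>

definition solves :: "(nat \<Rightarrow> int) \<Rightarrow> (nat \<Rightarrow> int) \<Rightarrow> (nat \<Rightarrow> int) \<Rightarrow> (nat \<Rightarrow> int) \<Rightarrow> (nat \<Rightarrow> int) \<Rightarrow> bool"
  where "solves x a b \<alpha> \<beta> \<longleftrightarrow>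
    (\<forall>i<r. \<forall>j<r. a i * x (L i j) + b i = \<alpha> j * x (L i j) + \<beta> j)"

definition equal_mod :: "int \<Rightarrow> (nat \<Rightarrow> int) \<Rightarrow> (nat \<Rightarrow> int) \<Rightarrow> bool" where
  "equal_mod p u v \<longleftrightarrow> (\<forall>i<r. \<forall>j<r. p dvd u i - v j)"

lemma solves_dvd:
  assumes "solves x a b \<alpha> \<beta>" "i < r" "j < r"
  shows "p dvd x (L i j) \<Longrightarrow> p dvd b i - \<beta> j"
    and "p dvd x (L i j) - 1 \<Longrightarrow> p dvd (a i + b i) - (\<alpha> j + \<beta> j)"
proof -
  have e: "a i * x (L i j) + b i = \<alpha> j * x (L i j) + \<beta> j"
    using assms by (auto simp: solves_def)
  have "b i - \<beta> j = x (L i j) * (\<alpha> j - a i)"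
    using e by (simp add: algebra_simps)
  then show "p dvd x (L i j) \<Longrightarrow> p dvd b i - \<beta> j" by simp
  have "(a i + b i) - (\<alpha> j + \<beta> j) = (x (L i j) - 1) * (\<alpha> j - a i)"
    using e by (simp add: algebra_simps)
  then show "p dvd x (L i j) - 1 \<Longrightarrow> p dvd (a i + b i) - (\<alpha> j + \<beta> j)" by simp
qed

lemma equal_mod_diff:
  assumes "equal_mod p (\<lambda>i. a i + b i) (\<lambda>j. \<alpha> j + \<beta> j)" "equal_mod p b \<beta>"
  shows "equal_mod p a \<alpha>"
  unfolding equal_mod_def
proof (intro allI impI)
  fix i j assume "i < r" "j < r"
  then have "p dvd ((a i + b i) - (\<alpha> j + \<beta> j)) - (b i - \<beta> j)"
    using assms unfolding equal_mod_def by (metis dvd_diff)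
  then show "p dvd a i - \<alpha> j" by (simp add: algebra_simps)
qed

lemma equal_mod_connects:
  assumes "connects S" "\<And>i j. \<lbrakk>i < r; j < r; L i j \<in> S\<rbrakk> \<Longrightarrow> p dvd u i - v j"
  shows "equal_mod p u v"
  unfolding equal_mod_def
proof (intro allI impI)
  fix i j assume "i < r" "j < r"
  then have "u i mod p = v j mod p"
    using connects_const[OF assms(1), of i j "\<lambda>i. u i mod p" "\<lambda>j. v j mod p"] assms(2)
    by (simp add: mod_eq_dvd_iff)
  then show "p dvd u i - v j" by (simp add: mod_eq_dvd_iff)
qed

text \<open>Modulo \<open>p\<close>, a symbol with \<open>x k \<equiv> 0\<close> equates intercepts, and a symbol with \<open>x k \<equiv> 1\<close> equates the sums of slope
  and intercept. Connectedness propagates both equalities to all lines.\<close>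

lemma connected_split_congruent:
  assumes sol: "solves x a b \<alpha> \<beta>"
    and x: "\<And>k. k \<in> S \<Longrightarrow> p dvd x k" "\<And>k. k \<in> {..<r} - S \<Longrightarrow> p dvd x k - 1"
    and con: "connects S" "connects ({..<r} - S)"
  shows "equal_mod p a \<alpha>" "equal_mod p b \<beta>"
proof -
  show b: "equal_mod p b \<beta>"
  proof (rule equal_mod_connects[OF con(1)])
    show "p dvd b i - \<beta> j" if "i < r" "j < r" "L i j \<in> S" for i j
      using solves_dvd(1)[OF sol that(1,2)] x(1)[OF that(3)] by blast
  qed
  have "equal_mod p (\<lambda>i. a i + b i) (\<lambda>j. \<alpha> j + \<beta> j)"
  proof (rule equal_mod_connects[OF con(2)])
    show "p dvd (a i + b i) - (\<alpha> j + \<beta> j)" if "i < r" "j < r" "L i j \<in> {..<r} - S" for i j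
      using solves_dvd(2)[OF sol that(1,2)] x(2)[OF that(3)] by blast
  qed
  then show "equal_mod p a \<alpha>" using equal_mod_diff b by blast
qed

text \<open>Summing the equations of one symbol over a union of components gives one linear relation between the sums of slopes
  and of intercepts. Two symbols with different abscissas separate the two sums.\<close>

lemma block_sums:
  assumes sol: "solves x a b \<alpha> \<beta>" and cl: "closed_under S R C"
    and k: "k \<in> S" "k' \<in> S" "k < r" "k' < r" "x k \<noteq> x k'"
  shows "sum a R = sum \<alpha> C" "sum b R = sum \<beta> C"
proof -
  have sub: "R \<subseteq> {..<r}" using cl by (auto simp: closed_under_def)
  have *: "x k * sum a R + sum b R = x k * sum \<alpha> C + sum \<beta> C" if k: "k \<in> S" "k < r" for k
  proof -
    have "x k * sum a R + sum b R = (\<Sum>i\<in>R. a i * x k + b i)"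
      by (simp add: sum.distrib sum_distrib_left mult.commute)
    also have "\<dots> = (\<Sum>i\<in>R. \<alpha> (cell k i) * x k + \<beta> (cell k i))"
      by (rule sum.cong) (use sol sub cell_props[OF _ k(2)] in \<open>force simp: solves_def\<close>)+
    also have "\<dots> = (\<Sum>j\<in>C. \<alpha> j * x k + \<beta> j)"
      by (rule sum.reindex_bij_betw[OF closed_under_bij[OF cl k]])
    also have "\<dots> = x k * sum \<alpha> C + sum \<beta> C"
      by (simp add: sum.distrib sum_distrib_left mult.commute)
    finally show ?thesis .
  qed
  have "(x k - x k') * (sum a R - sum \<alpha> C) = 0"
    using *[OF k(1,3)] *[OF k(2,4)] by (simp add: algebra_simps)
  then show "sum a R = sum \<alpha> C" using k by simp
  then show "sum b R = sum \<beta> C" using *[OF k(1,3)] by simp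
qed

lemma average_congruent:
  fixes u v :: "nat \<Rightarrow> int" and p :: int
  assumes "\<And>i. i \<in> R \<Longrightarrow> p dvd u i - u0" "\<And>j. j \<in> C \<Longrightarrow> p dvd v j - v0"
    and "sum u R = sum v C" "card R = s" "card C = s" "prime p" "\<not> p dvd int s"
  shows "p dvd u0 - v0"
proof -
  have "p dvd (\<Sum>j\<in>C. v j - v0) - (\<Sum>i\<in>R. u i - u0)"
    using assms(1,2) by (metis dvd_diff dvd_sum)
  also have "(\<Sum>j\<in>C. v j - v0) - (\<Sum>i\<in>R. u i - u0) = int s * (u0 - v0)"
    using assms(3-5) by (simp add: sum_subtractf algebra_simps)
  finally show ?thesis using assms(6,7) by (simp add: prime_dvd_mult_iff)
qed

text \<open>The block structure of a disconnected half split leaves two classes of congruent values; equal sums over \<open>R\<close> and the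
  complement of \<open>C\<close>, one set from each class, merge them because \<open>s\<close> is invertible modulo \<open>p\<close>.\<close>

lemma equal_mod_blocks:
  assumes sub: "R \<subseteq> {..<r}" "C \<subseteq> {..<r}" and ne: "R \<noteq> {}" "C \<noteq> {}" "R \<noteq> {..<r}" "C \<noteq> {..<r}"
    and e: "\<And>i j. \<lbrakk>i \<in> R; j \<in> C\<rbrakk> \<Longrightarrow> p dvd u i - v j"
      "\<And>i j. \<lbrakk>i \<in> {..<r} - R; j \<in> {..<r} - C\<rbrakk> \<Longrightarrow> p dvd u i - v j"
    and s: "sum u R = sum v ({..<r} - C)" "card R = s" "card ({..<r} - C) = s"
    and p: "prime p" "\<not> p dvd int s"
  shows "equal_mod p u v"
proof -
  obtain i0 j0 i1 j1 where w: "i0 \<in> R" "j0 \<in> C" "i1 \<in> {..<r} - R" "j1 \<in> {..<r} - C"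
    using sub ne by blast
  have m1: "u i mod p = v j mod p" if "i \<in> R" "j \<in> C" for i j
    using e that by (simp add: mod_eq_dvd_iff)
  have m2: "u i mod p = v j mod p" if "i \<in> {..<r} - R" "j \<in> {..<r} - C" for i j
    using e(2)[OF that] by (simp add: mod_eq_dvd_iff)
  have "p dvd u i0 - v j1"
  proof (rule average_congruent[OF _ _ s p])
    show "p dvd u i - u i0" if "i \<in> R" for i
      using m1[OF that w(2)] m1[OF w(1,2)] by (simp flip: mod_eq_dvd_iff)
    show "p dvd v j - v j1" if "j \<in> {..<r} - C" for j
      using m2[OF w(3) that] m2[OF w(3,4)] by (simp flip: mod_eq_dvd_iff)
  qed
  then have j: "u i0 mod p = v j1 mod p" by (simp add: mod_eq_dvd_iff)
  have "u i mod p = u i0 mod p" if "i < r" for i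
    using m1[of i j0] m1[of i0 j0] m2[of i j1] w j that by (cases "i \<in> R") auto
  moreover have "v k mod p = u i0 mod p" if "k < r" for k
    using m1[of i0 k] m2[of i1 j1] m2[of i1 k] w j that by (cases "k \<in> C") auto
  ultimately show ?thesis by (simp add: equal_mod_def flip: mod_eq_dvd_iff)
qed

lemma half_split_congruent:
  assumes r: "r = 2 * s" "2 \<le> s" and p: "prime p" "\<not> p dvd int s"
    and inj: "inj_on x {..<r}" and S: "S \<subseteq> {..<r}" "card S = s"
    and x: "\<And>k. k \<in> S \<Longrightarrow> p dvd x k" "\<And>k. k \<in> {..<r} - S \<Longrightarrow> p dvd x k - 1"
    and sol: "solves x a b \<alpha> \<beta>"
  shows "equal_mod p a \<alpha> \<and> equal_mod p b \<beta>"
proof -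
  have "0 < s" using r by simp
  from r(1) this S show ?thesis
  proof (cases rule: half_split)
    case 1 then show ?thesis using connected_split_congruent[OF sol x] by blast
  next
    case (2 R C)
    let ?C' = "{..<r} - C" and ?S' = "{..<r} - S"
    have sub: "R \<subseteq> {..<r}" "C \<subseteq> {..<r}" using 2(1) by (auto simp: closed_under_def)
    have fin: "finite S" "finite R" "finite C" using sub S by (auto intro: finite_subset)
    have ne: "R \<noteq> {}" "C \<noteq> {}" "R \<noteq> {..<r}" "C \<noteq> {..<r}" 
      using 2(2,3) r by (metis card.empty card_lessThan not_numeral_le_zero mult_2 add_right_cancel
          add_0 le_add2 le_zero_eq)+
    have C': "card ?C' = s" "?C' \<subseteq> {..<r}" "?C' \<noteq> {}" "?C' \<noteq> {..<r}"

    proof -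
      show "card ?C' = s" using 2(3) sub r fin by (simp add: card_Diff_subset)
      show "?C' \<subseteq> {..<r}" "?C' \<noteq> {}" "?C' \<noteq> {..<r}" using sub ne by blast+
    qed
    have two: "\<exists>k k'. k \<in> T \<and> k' \<in> T \<and> k < r \<and> k' < r \<and> x k \<noteq> x k'"
      if "T \<subseteq> {..<r}" "card T = s" for T

    proof -
      have "finite T" using that(1) by (rule finite_subset) simp
      then obtain k k' where "k \<in> T" "k' \<in> T" "k \<noteq> k'"
        using ex_two[of T] \<open>card T = s\<close> r(2) by auto
      moreover from this have "k < r" "k' < r" using \<open>T \<subseteq> {..<r}\<close> by auto
      ultimately show ?thesis using inj unfolding inj_on_def by blast
    qed
    obtain k k' where k: "k \<in> S" "k' \<in> S" "k < r" "k' < r" "x k \<noteq> x k'"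
      using two[OF S] by blast
    have "card ?S' = s" using S r fin by (simp add: card_Diff_subset)
    then obtain l l' where l: "l \<in> ?S'" "l' \<in> ?S'" "l < r" "l' < r" "x l \<noteq> x l'"
      using two[of ?S'] by blast
    note s1 = block_sums[OF sol 2(1) k] and s2 = block_sums[OF sol 2(6) l]
    have lt: "i < r" if "i \<in> R" for i using sub that by auto
    have lt': "i < r" if "i \<in> C" for i using sub that by auto
    have b: "equal_mod p b \<beta>"
    proof (rule equal_mod_blocks[OF sub ne _ _ s2(2) 2(2) C'(1) p])
      show "p dvd b i - \<beta> j" if "i \<in> R" "j \<in> C" for i j
        using solves_dvd(1)[OF sol] x(1) 2(4)[OF that] that lt lt' by blast
      show "p dvd b i - \<beta> j" if "i \<in> {..<r} - R" "j \<in> ?C'" for i j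
        using solves_dvd(1)[OF sol] x(1) 2(5)[OF that] that by blast
    qed
    have CC: "{..<r} - ?C' = C" using sub by auto
    have "equal_mod p (\<lambda>i. a i + b i) (\<lambda>j. \<alpha> j + \<beta> j)"
    proof (rule equal_mod_blocks[OF sub(1) C'(2) ne(1) C'(3) ne(3) C'(4) _ _ _ 2(2) _ p])
      show "p dvd (a i + b i) - (\<alpha> j + \<beta> j)" if "i \<in> R" "j \<in> ?C'" for i j
        using solves_dvd(2)[OF sol] x(2) 2(7)[OF that] that lt by blast
      show "p dvd (a i + b i) - (\<alpha> j + \<beta> j)" if "i \<in> {..<r} - R" "j \<in> {..<r} - ?C'" for i j
        using solves_dvd(2)[OF sol] x(2) 2(8)[of i j] that CC by blast
      show "(\<Sum>i\<in>R. a i + b i) = (\<Sum>j\<in>{..<r} - ?C'. \<alpha> j + \<beta> j)"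
        using s1 CC by (simp add: sum.distrib)
      show "card ({..<r} - ?C') = s" using CC 2(3) by simp
    qed
    then show ?thesis using equal_mod_diff b by blast
  qed
qed

text \<open>If every solution is constant modulo \<open>p\<close>, then subtracting the constants and dividing by \<open>p\<close> gives another solution.
  Repeating this shows that the differences are divisible by all powers of \<open>p\<close>.\<close>

lemma solutions_trivial_by_descent:
  assumes p: "p > 1" and r: "0 < r"
    and cong: "\<And>a b \<alpha> \<beta>. solves x a b \<alpha> \<beta> \<Longrightarrow> equal_mod p a \<alpha> \<and> equal_mod p b \<beta>"
    and sol: "solves x a b \<alpha> \<beta>"
  shows "a 0 = \<alpha> 0 \<and> b 0 = \<beta> 0"
proof -
  have deep: "equal_mod (p ^ N) a \<alpha> \<and> equal_mod (p ^ N) b \<beta>" if "solves x a b \<alpha> \<beta>" for N a b \<alpha> \<beta>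
    using that
  proof (induction N arbitrary: a b \<alpha> \<beta>)
    case 0 then show ?case by (simp add: equal_mod_def)
  next
    case (Suc N)
    have p0: "p \<noteq> 0" using p by simp
    have quot: "\<exists>u' v'. (\<forall>i<r. u i = p * u' i + u 0) \<and> (\<forall>j<r. v j = p * v' j + u 0)"
      if "equal_mod p u v" for u v
    proof -
      have "p dvd u i - u 0" if "i < r" for i
      proof -
        have "p dvd (u i - v 0) - (u 0 - v 0)"
          using \<open>equal_mod p u v\<close> that r unfolding equal_mod_def by (metis dvd_diff)
        then show ?thesis by simp
      qed
      moreover have "p dvd v j - u 0" if "j < r" for j
        using \<open>equal_mod p u v\<close> that r by (auto simp: equal_mod_def dvd_diff_commute)
      ultimately show ?thesis
        by (intro exI[of _ "\<lambda>i. (u i - u 0) div p"] exI[of _ "\<lambda>j. (v j - u 0) div p"]) simp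
    qed
    obtain a' \<alpha>' where a: "\<forall>i<r. a i = p * a' i + a 0" "\<forall>j<r. \<alpha> j = p * \<alpha>' j + a 0"
      using quot cong[OF Suc.prems] by blast
    obtain b' \<beta>' where b: "\<forall>i<r. b i = p * b' i + b 0" "\<forall>j<r. \<beta> j = p * \<beta>' j + b 0"
      using quot cong[OF Suc.prems] by blast
    have "solves x a' b' \<alpha>' \<beta>'"
      unfolding solves_def
    proof (intro allI impI)
      fix i j assume ij: "i < r" "j < r"
      define t where "t = x (L i j)"
      have "(p * a' i + a 0) * t + (p * b' i + b 0) = (p * \<alpha>' j + a 0) * t + (p * \<beta>' j + b 0)"
        using Suc.prems ij a b unfolding solves_def t_def by metis
      then have "p * (a' i * t + b' i) = p * (\<alpha>' j * t + \<beta>' j)"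
        by (simp add: algebra_simps)
      then show "a' i * x (L i j) + b' i = \<alpha>' j * x (L i j) + \<beta>' j"
        using p0 by (simp add: t_def)
    qed
    then have IH: "equal_mod (p ^ N) a' \<alpha>'" "equal_mod (p ^ N) b' \<beta>'" using Suc.IH by auto
    have "a i - \<alpha> j = p * (a' i - \<alpha>' j)" "b i - \<beta> j = p * (b' i - \<beta>' j)" if "i < r" "j < r" for i j
      using a b that by (metis add_diff_cancel_right right_diff_distrib)+
    then show ?case using IH by (simp add: equal_mod_def mult_dvd_mono)
  qed
  have zero: "z = 0" if "\<And>N. p ^ N dvd z" for z :: int
  proof (rule ccontr)
    assume z: "z \<noteq> 0"
    have "int (nat \<bar>z\<bar>) < int (nat p ^ nat \<bar>z\<bar>)"
      using power_gt_expt[of "nat p" "nat \<bar>z\<bar>"] p unfolding of_nat_less_iff by simp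
    then have "\<bar>z\<bar> < p ^ nat \<bar>z\<bar>" using p unfolding of_nat_power by simp
    moreover have "\<bar>p ^ nat \<bar>z\<bar>\<bar> \<le> \<bar>z\<bar>" by (rule dvd_imp_le_int[OF z that])
    ultimately show False by linarith
  qed
  have "a 0 - \<alpha> 0 = 0" "b 0 - \<beta> 0 = 0"
    using deep[OF sol] r by (auto simp: equal_mod_def intro!: zero[of "a 0 - \<alpha> 0", simplified]
        zero[of "b 0 - \<beta> 0", simplified])
  then show ?thesis by simp
qed

end

text \<open>For even \<open>r\<close> a single cut of the symbols into halves suffices. For odd \<open>r\<close> the cut must be adapted to the Latin
  square, and the middle symbol \<open>s\<close> is the only one that changes sides. Hence two primes suffice: modulo \<open>p\<close> the
  abscissa of \<open>s\<close> is 1 and modulo \<open>q\<close> it is 0, while the smaller symbols have abscissa 0 and the larger ones 1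
  modulo both.\<close>

lemma generic_directions:
  assumes r: "4 \<le> r"
  obtains x :: "nat \<Rightarrow> int" where "inj_on x {..<r}"
    and "\<And>L a b \<alpha> \<beta>. \<lbrakk>latin_square r L; latin_square.solves r L x a b \<alpha> \<beta>\<rbrakk> \<Longrightarrow> a 0 = \<alpha> 0 \<and> b 0 = \<beta> 0"
proof -
  define s where "s = r div 2"
  have s: "2 \<le> s" "s < r" using r by (auto simp: s_def)
  obtain p' where p': "prime p'" "r < p'" using bigger_prime by blast
  obtain q' where q': "prime q'" "p' < q'" using bigger_prime by blast
  define p q where "p = int p'" and "q = int q'"
  have pq: "prime p" "prime q" "int r < p" "p < q" using p' q' by (auto simp: p_def q_def)
  have "coprime q p" using pq by (intro primes_coprime) auto
  then obtain y where y: "[q * y = 1] (mod p)" using cong_solve_coprime_int by blast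
  \<comment> \<open>By the choice of \<open>y\<close>, the abscissa \<open>q * y\<close> is 1 modulo \<open>p\<close> and 0 modulo \<open>q\<close>; the summands \<open>k * (p * q)\<close>
    keep the other abscissas distinct without changing their residues.\<close>
  define x :: "nat \<Rightarrow> int" where "x = (\<lambda>k. if k < s then int k * (p * q) else if k = s then q * y
     else 1 + int k * (p * q))"
  have x0: "p dvd x k" "q dvd x k" if "k < s" for k using that by (auto simp: x_def)
  have x1: "p dvd x k - 1" "q dvd x k - 1" if "s < k" for k using that by (auto simp: x_def)
  have xs: "p dvd x s - 1" "q dvd x s" using y by (auto simp: x_def cong_iff_dvd_diff)
  have p1: "\<not> p dvd 1" "\<not> q dvd 1" using pq by (auto simp: prime_int_iff)
  have pq0: "p * q \<noteq> 0" using pq by auto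
  have lt: "x k \<noteq> x l" if kl: "k < l" "l < r" for k l
  proof
    assume e: "x k = x l"
    consider "l < s" | "k < s" "s \<le> l" | "k = s" "s < l" | "s < k" 
      using kl by (metis linorder_neqE_nat not_less)
    then show False
    proof cases
      case 1 then show False using e kl pq0 by (simp add: x_def)
    next
      case 2
      then have "p dvd x k" using x0 by simp
      moreover have "p dvd x l - 1" using 2 x1[of l] xs by (cases "s = l") auto
      then have "p dvd x k - 1" using e by simp
      ultimately
have "p dvd x k - (x k - 1)" by (rule dvd_diff)
      then show False using p1 by simp
    next
      case 3
      then have "q dvd x k" "q dvd x k - 1" using x1[of l] xs e by auto
      then have "q dvd x k - (x k - 1)" by (rule dvd_diff)
      then show False using p1 by simp
    next
      case 4 then show False using e kl pq0 by (simp add: x_def)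
    qed
  qed
  then have inj: "inj_on x {..<r}" by (metis inj_onI lessThan_iff linorder_neqE_nat)
  show thesis
  proof (rule that[OF inj])
    fix L a b \<alpha> \<beta>
    assume L: "latin_square r L" and sol: "latin_square.solves r L x a b \<alpha> \<beta>"
    interpret latin_square r L by fact
    note desc = solutions_trivial_by_descent[OF _ _ _ sol]
    show "a 0 = \<alpha> 0 \<and> b 0 = \<beta> 0"
    proof (cases "even r")
      case True
      then have rs: "r = 2 * s" by (simp add: s_def)
      have ps: "\<not> p dvd int s" using pq s zdvd_not_zless by fastforce
      have "equal_mod p a \<alpha> \<and> equal_mod p b \<beta>" if "solves x a b \<alpha> \<beta>" for a b \<alpha> \<beta>
        by (rule half_split_congruent[OF rs s(1) pq(1) ps inj, of "{..<s}"])
           (use that s x0 x1 xs in \<open>auto simp: le_less not_less\<close>)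
      then show ?thesis by (rule desc[rotated 2]) (use r pq in auto)
    next
      case False
      then have "r = 2 * s + 1" by (simp add: s_def)
      then show ?thesis using s(1)
      proof (cases rule: odd_split)
        case 1
        have "equal_mod p a \<alpha> \<and> equal_mod p b \<beta>" if "solves x a b \<alpha> \<beta>" for a b \<alpha> \<beta>
          using connected_split_congruent[OF that _ _ 1, of p] x0 x1 xs
          by (auto simp: le_less not_less)
        then show ?thesis by (rule desc[rotated 2]) (use r pq in auto)
      next
        case 2
        have "equal_mod q a \<alpha> \<and> equal_mod q b \<beta>" if "solves x a b \<alpha> \<beta>" for a b \<alpha> \<beta>
        proof -
          have "q dvd x k" if "k \<in> {..<Suc s}" for k using that x0 xs by (cases "k = s") auto
          moreover have "q dvd x k - 1" if "k \<in> {..<r} - {..<Suc s}" for k using that x1 by auto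
          ultimately show ?thesis using connected_split_congruent[OF that _ _ 2, of q] by blast
        qed
        then show ?thesis by (rule desc[rotated 2]) (use r pq in auto)
      qed
    qed
  qed
qed

definition integer_linear :: "(('i \<Rightarrow> int) \<Rightarrow> int) \<Rightarrow> bool" where
  "integer_linear e \<longleftrightarrow> (\<forall>u v M N. e (\<lambda>i. M * u i + N * v i) = M * e u + N * e v)"

text \<open>Gaussian elimination over the integers, recording only the product \<open>D\<close> of the pivots: what follows from
  homogeneous equations over the integers follows modulo every \<open>m\<close> coprime to \<open>D\<close>. The pivot for \<open>e\<close> is its value at a common zero \<open>v0\<close>
  of the other forms at which \<open>e\<close> does not vanish.\<close>

lemma integral_elimination:
  fixes E :: "(('i \<Rightarrow> int) \<Rightarrow> int) set"
  assumes "finite E" "\<And>e. e \<in> E \<Longrightarrow> integer_linear e" "integer_linear w"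
    and "\<And>v. (\<forall>e\<in>E. e v = 0) \<Longrightarrow> w v = 0"
  shows "\<exists>D. D \<noteq> 0 \<and> (\<forall>m v. coprime m D \<longrightarrow> (\<forall>e\<in>E. m dvd e v) \<longrightarrow> m dvd w v)"
  using assms
proof (induction E arbitrary: w rule: finite_induct)
  case empty
  then show ?case by (intro exI[of _ 1]) auto
next
  case (insert e E)
  show ?case
  proof (cases "\<forall>v. (\<forall>f\<in>E. f v = 0) \<longrightarrow> e v = 0")
    case True
    then have "\<exists>D. D \<noteq> 0 \<and> (\<forall>m v. coprime m D \<longrightarrow> (\<forall>f\<in>E. m dvd f v) \<longrightarrow> m dvd w v)"
      using insert.prems by (intro insert.IH) auto
    then show ?thesis by blast
  next
    case False
    then obtain v0 where v0: "\<forall>f\<in>E. f v0 = 0" "e v0 \<noteq> 0" by blast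
    \<comment> \<open>\<open>w'\<close> vanishes at \<open>v0\<close> and hence on all common zeros of \<open>E\<close>; \<open>e\<close> has been eliminated.\<close>
    define w' where "w' = (\<lambda>v. e v0 * w v - w v0 * e v)"
    have lin: "integer_linear w'"
    proof -
      have "integer_linear e" "integer_linear w" using insert.prems(1,2) by auto
      then show ?thesis unfolding integer_linear_def w'_def by (simp add: algebra_simps)
    qed
    have "w' v = 0" if v: "\<forall>f\<in>E. f v = 0" for v
    proof -
      let ?u = "\<lambda>i. e v0 * v i + (- e v) * v0 i"
      have val: "f ?u = e v0 * f v + (- e v) * f v0" if "integer_linear f" for f
        using that unfolding integer_linear_def by blast
      have "\<forall>f\<in>insert e E. f ?u = 0" 
      proof
        fix f assume f: "f \<in> insert e E"
        have "f ?u = e v0 * f v + (- e v) * f v0" using val insert.prems(1) f by blast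
        then show "f ?u = 0" using f v v0 by auto
      qed
      then have "w ?u = 0" using insert.prems(3) by blast
      then show ?thesis using val[OF insert.prems(2)] by (simp add: w'_def algebra_simps)
    qed
    then obtain D where D: "D \<noteq> 0"
      "\<And>m v. \<lbrakk>coprime m D; \<forall>f\<in>E. m dvd f v\<rbrakk> \<Longrightarrow> m dvd w' v"
      using insert.IH[OF _ lin] insert.prems(1) by blast
    show ?thesis
    proof (intro exI[of _ "D * e v0"] conjI allI impI)
      show "D * e v0 \<noteq> 0" using D v0 by simp
      fix m v assume m: "coprime m (D * e v0)" and v: "\<forall>f\<in>insert e E. m dvd f v"
      have "m dvd w' v + w v0 * e v" using D(2)[of m v] m v by auto
      then have "m dvd e v0 * w v" by (simp add: w'_def)
      then show "m dvd w v" using m by (simp add: coprime_dvd_mult_right_iff)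
    qed
  qed
qed

text \<open>There are only finitely many sets of equations, indexed by the triples of row, column and symbol; one modulus bound
  \<open>D\<close> serves all Latin squares at once.\<close>

lemma generic_directions_mod:
  assumes r: "4 \<le> r"
  obtains x :: "nat \<Rightarrow> int" and D :: int where "D > 0"
    and "\<And>m k l. \<lbrakk>coprime m D; k < r; l < r; k \<noteq> l\<rbrakk> \<Longrightarrow> coprime m (x k - x l)"
    and "\<And>m L a b \<alpha> \<beta>. \<lbrakk>coprime m D; latin_square r L;
        \<And>i j. \<lbrakk>i < r; j < r\<rbrakk> \<Longrightarrow> m dvd (a i * x (L i j) + b i) - (\<alpha> j * x (L i j) + \<beta> j)\<rbrakk>
        \<Longrightarrow> m dvd a 0 - \<alpha> 0 \<and> m dvd b 0 - \<beta> 0"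
proof -
  obtain x :: "nat \<Rightarrow> int" where inj: "inj_on x {..<r}"
    and triv: "\<And>L a b \<alpha> \<beta>. \<lbrakk>latin_square r L; latin_square.solves r L x a b \<alpha> \<beta>\<rbrakk> \<Longrightarrow> a 0 = \<alpha> 0 \<and> b 0 = \<beta> 0"
    using generic_directions[OF r] by blast
  define e :: "nat \<times> nat \<times> nat \<Rightarrow> (nat \<times> nat \<Rightarrow> int) \<Rightarrow> int" where
    "e = (\<lambda>(i, j, k) v. (v (0, i) * x k + v (1, i)) - (v (2, j) * x k + v (3, j)))"
  define T where "T = {..<r} \<times> {..<r} \<times> {..<r}"
  have lin: "integer_linear (e t)" for t
    by (cases t) (simp add: e_def integer_linear_def algebra_simps)
  define wa wb :: "(nat \<times> nat \<Rightarrow> int) \<Rightarrow> int"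
    where "wa = (\<lambda>v. v (0, 0) - v (2, 0))" and "wb = (\<lambda>v. v (1, 0) - v (3, 0))"
  have linw: "integer_linear wa" "integer_linear wb"
    by (simp_all add: wa_def wb_def integer_linear_def algebra_simps)
  define good where "good = (\<lambda>U D. D \<noteq> 0 \<and> (\<forall>m v. coprime m D \<longrightarrow> (\<forall>t\<in>U. m dvd e t v)
      \<longrightarrow> m dvd wa v \<and> m dvd wb v))"
  \<comment> \<open>The value 1 for systems with nontrivial solutions only keeps the product \<open>D1\<close> nonzero.\<close>
  define D0 where "D0 = (\<lambda>U. if \<exists>D. good U D then SOME D. good U D else 1)"
  have good_D0: "good U (D0 U)" if "good U D" for U D
  proof -
    have "\<exists>D. good U D" using that by blast
    then show ?thesis unfolding D0_def if_P[OF \<open>\<exists>D. good U D\<close>] by (rule someI_ex)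
  qed
  have D0_nz: "D0 U \<noteq> 0" for U
  proof (cases "\<exists>D. good U D")
    case True
    then show ?thesis using good_D0 unfolding good_def by blast
  next
    case False
    then show ?thesis unfolding D0_def if_not_P[OF False] by simp
  qed
  \<comment> \<open>\<open>D1\<close> collects the pivots of all systems, \<open>D2\<close> the differences of the abscissas.\<close>
  define D1 where "D1 = (\<Prod>U\<in>Pow T. D0 U)"
  define D2 where "D2 = (\<Prod>k<r. \<Prod>l<r. if k = l then 1 else x k - x l)"
  have finT: "finite T" by (simp add: T_def)
  have nz: "D1 \<noteq> 0" "D2 \<noteq> 0"
    using D0_nz finT inj by (auto simp: D1_def D2_def inj_on_def prod_zero_iff)
  show thesis
  proof (rule that[of "\<bar>D1 * D2\<bar>" x])
    show "\<bar>D1 * D2\<bar> > 0" using nz by simp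
  next
    fix m k l assume m: "coprime m \<bar>D1 * D2\<bar>" and kl: "k < r" "l < r" "k \<noteq> l"
    have "(\<Prod>l<r. if k = l then 1 else x k - x l) dvd D2"
      unfolding D2_def using kl by (intro dvd_prodI) auto
    moreover have "(if k = l then 1 else x k - x l) dvd (\<Prod>l<r. if k = l then 1 else x k - x l)"
      using kl by (intro dvd_prodI) auto
    ultimately have "x k - x l dvd D2" using kl by (auto intro: dvd_trans)
    moreover have "coprime m D2" using m by simp
    ultimately show "coprime m (x k - x l)" using coprime_divisors[of m m _ D2] by simp
  next
    fix m L a b \<alpha> \<beta>
    assume m: "coprime m \<bar>D1 * D2\<bar>" and L: "latin_square r L"
      and h: "\<And>i j. \<lbrakk>i < r; j < r\<rbrakk> \<Longrightarrow> m dvd (a i * x (L i j) + b i) - (\<alpha> j * x (L i j) + \<beta> j)"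
    interpret latin_square r L by fact
    define U where "U = (\<lambda>(i, j). (i, j, L i j)) ` ({..<r} \<times> {..<r})"
    have U: "U \<in> Pow T" using entry by (auto simp: U_def T_def)
    have triv': "wa v = 0 \<and> wb v = 0" if "\<forall>f\<in>e ` U. f v = 0" for v
    proof -
      have "solves x (\<lambda>i. v (0, i)) (\<lambda>i. v (1, i)) (\<lambda>i. v (2, i)) (\<lambda>i. v (3, i))"
        using that by (force simp: solves_def U_def e_def)
      then show ?thesis using triv[OF L] by (simp add: wa_def wb_def)
    qed
    have finU: "finite (e ` U)" by (simp add: U_def)
    obtain Da where Da: "Da \<noteq> 0" "\<And>m v. \<lbrakk>coprime m Da; \<forall>f\<in>e ` U. m dvd f v\<rbrakk> \<Longrightarrow> m dvd wa v"
      using integral_elimination[OF finU _ linw(1)] lin triv' by blast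
    obtain Db where Db: "Db \<noteq> 0" "\<And>m v. \<lbrakk>coprime m Db; \<forall>f\<in>e ` U. m dvd f v\<rbrakk> \<Longrightarrow> m dvd wb v"
      using integral_elimination[OF finU _ linw(2)] lin triv' by blast
    have "good U (Da * Db)" using Da Db unfolding good_def by simp
    then have g: "good U (D0 U)" by (rule good_D0)
    have "D0 U dvd D1" unfolding D1_def using U finT by (intro dvd_prodI) auto
    moreover have "coprime m D1" using m by simp
    ultimately have "coprime m (D0 U)" using coprime_divisors[of m m _ D1] by simp
    moreover define v :: "nat \<times> nat \<Rightarrow> int" where
      "v = (\<lambda>(c, i). if c = 0 then a i else if c = 1 then b i else if c = 2 then \<alpha> i else \<beta> i)"
    moreover have "\<forall>t\<in>U. m dvd e t v" using h by (auto simp: U_def e_def v_def)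
    ultimately have "m dvd wa v \<and> m dvd wb v" using g unfolding good_def by blast
    then show "m dvd a 0 - \<alpha> 0 \<and> m dvd b 0 - \<beta> 0" by (simp add: wa_def wb_def v_def)
  qed
qed

section \<open>Grids and their crossing points\<close>

definition is_grid :: "nat \<Rightarrow> (nat \<Rightarrow> 'a set) \<Rightarrow> (nat \<Rightarrow> 'a set) \<Rightarrow> bool" where
  "is_grid r A B \<longleftrightarrow> (\<forall>i<r. \<forall>j<r. i \<noteq> j \<longrightarrow> A i \<inter> A j = {} \<and> B i \<inter> B j = {}) \<and>
     (\<forall>i<r. \<forall>j<r. card (A i \<inter> B j) = 1)"

lemma is_grid_swap: "is_grid r A B \<Longrightarrow> is_grid r B A"
  by (auto simp: is_grid_def Int_commute)

lemma contains_gridE: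
  assumes "contains_grid r F"
  obtains A B where "is_grid r A B" "\<And>i. i < r \<Longrightarrow> A i \<in> F" "\<And>j. j < r \<Longrightarrow> B j \<in> F"
proof -
  obtain A B where h: "A ` {1..r} \<subseteq> F" "B ` {1..r} \<subseteq> F"
    "\<forall>i j. 1 \<le> i \<and> i < j \<and> j \<le> r \<longrightarrow> A i \<inter> A j = {} \<and> B i \<inter> B j = {}"
    "\<forall>i\<in>{1..r}. \<forall>j\<in>{1..r}. card (A i \<inter> B j) = 1"
    using assms unfolding contains_grid_def by (elim exE conjE)
  have "is_grid r (\<lambda>i. A (Suc i)) (\<lambda>j. B (Suc j))"
    unfolding is_grid_def
  proof (intro conjI allI impI)
    fix i j assume "i < r" "j < r" "i \<noteq> j"
    then have "A (Suc i) \<inter> A (Suc j) = {} \<and> B (Suc i) \<inter> B (Suc j) = {}"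
      using h(3)[rule_format, of "Suc i" "Suc j"] h(3)[rule_format, of "Suc j" "Suc i"]
      by (cases "i < j") (simp_all add: Int_commute)
    then show "A (Suc i) \<inter> A (Suc j) = {}" "B (Suc i) \<inter> B (Suc j) = {}" by auto
  next
    fix i j assume "i < r" "j < r"
    then show "card (A (Suc i) \<inter> B (Suc j)) = 1" using h(4)[rule_format, of "Suc i" "Suc j"] by simp
  qed
  moreover have "A (Suc i) \<in> F" "B (Suc i) \<in> F" if "i < r" for i
    using h(1,2) that by (auto simp: image_subset_iff)
  ultimately show ?thesis using that by blast
qed

text \<open>The \<open>2r\<close> edges are distinct because an edge with \<open>r \<ge> 2\<close> elements is neither disjoint from itself nor
  meets itself in one point.\<close>

lemma contains_gridI:
  assumes g: "is_grid r A B" and F: "\<And>i. i < r \<Longrightarrow> A i \<in> F" "\<And>j. j < r \<Longrightarrow> B j \<in> F"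
    and r: "2 \<le> r" "\<And>e. e \<in> F \<Longrightarrow> card e = r"
  shows "contains_grid r F"
proof -
  have d: "\<And>i j. \<lbrakk>i < r; j < r; i \<noteq> j\<rbrakk> \<Longrightarrow> A i \<inter> A j = {} \<and> B i \<inter> B j = {}"
    and c: "\<And>i j. \<lbrakk>i < r; j < r\<rbrakk> \<Longrightarrow> card (A i \<inter> B j) = 1"
    using g by (auto simp: is_grid_def)
  have ne: "A i \<noteq> {}" "B i \<noteq> {}" if "i < r" for i using F r that by fastforce+
  have lt: "i - 1 < r" if "i \<in> {1..r}" for i using that by auto
  have neq: "i - 1 \<noteq> j - 1" if "i \<in> {1..r}" "j \<in> {1..r}" "i \<noteq> j" for i j :: nat using that by auto
  show ?thesis
    unfolding contains_grid_def
  proof (intro exI conjI allI impI ballI)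
    show "(\<lambda>i. A (i - 1)) ` {1..r} \<subseteq> F" "(\<lambda>i. B (i - 1)) ` {1..r} \<subseteq> F" using F lt by auto
    show "inj_on (\<lambda>i. A (i - 1)) {1..r}"
      by (rule inj_onI) (metis d ne lt neq Int_absorb)
    show "inj_on (\<lambda>i. B (i - 1)) {1..r}"
      by (rule inj_onI) (metis d ne lt neq Int_absorb)
    have "A (i - 1) \<noteq> B (j - 1)" if "i \<in> {1..r}" "j \<in> {1..r}" for i j
    proof
      assume e: "A (i - 1) = B (j - 1)"
      then have "card (A (i - 1)) = 1" using c[OF lt[OF that(1)] lt[OF that(2)]] by simp
      then show False using r(2)[OF F(1)[OF lt[OF that(1)]]] r(1) by simp
    qed
    then show "(\<lambda>i. A (i - 1)) ` {1..r} \<inter> (\<lambda>i. B (i - 1)) ` {1..r} = {}" by blast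
    fix i j :: nat
    show "A (i - 1) \<inter> A (j - 1) = {}" "B (i - 1) \<inter> B (j - 1) = {}" if "1 \<le> i \<and> i < j \<and> j \<le> r"
    proof -
      have "i - 1 < r" "j - 1 < r" "i - 1 \<noteq> j - 1" using that by auto
      then show "A (i - 1) \<inter> A (j - 1) = {}" "B (i - 1) \<inter> B (j - 1) = {}" using d by blast+
    qed
    show "card (A (i - 1) \<inter> B (j - 1)) = 1" if "i \<in> {1..r}" "j \<in> {1..r}"
      using c lt that by blast
  qed
qed

lemma contains_grid_inj_image:
  assumes "contains_grid r ((`) h ` F)" "inj_on h V" "\<And>e. e \<in> F \<Longrightarrow> e \<subseteq> V"
    and r: "2 \<le> r" "\<And>e. e \<in> F \<Longrightarrow> card e = r"
  shows "contains_grid r F"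
proof -
  obtain A B where g: "is_grid r A B" and AB: "\<And>i. i < r \<Longrightarrow> A i \<in> (`) h ` F" "\<And>j. j < r \<Longrightarrow> B j \<in> (`) h ` F"
    using contains_gridE[OF assms(1)] by blast
  obtain A' where A': "\<And>i. i < r \<Longrightarrow> A' i \<in> F \<and> A i = h ` A' i"
    using AB(1) unfolding image_iff by metis
  obtain B' where B': "\<And>j. j < r \<Longrightarrow> B' j \<in> F \<and> B j = h ` B' j"
    using AB(2) unfolding image_iff by metis
  have int: "h ` (X \<inter> Y) = h ` X \<inter> h ` Y" if "X \<in> F" "Y \<in> F" for X Y
    using inj_on_image_Int[OF assms(2)] assms(3) that by blast
  have cd: "card (h ` (X \<inter> Y)) = card (X \<inter> Y)" if "X \<in> F" for X Y
    using assms(2,3) that by (meson card_image inf.coboundedI1 inj_on_subset)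
  have "is_grid r A' B'"
    unfolding is_grid_def
  proof (intro conjI allI impI)
    fix i j assume ij: "i < r" "j < r"
    show "card (A' i \<inter> B' j) = 1"
      using g ij A'[OF ij(1)] B'[OF ij(2)] int cd unfolding is_grid_def by metis
    assume "i \<noteq> j"
    then show "A' i \<inter> A' j = {}" "B' i \<inter> B' j = {}"
      using g ij A'[OF ij(1)] A'[OF ij(2)] B'[OF ij(1)] B'[OF ij(2)] int
      unfolding is_grid_def by (metis image_is_empty)+
  qed
  then show ?thesis using contains_gridI[of r A' B' F] A' B' r by blast
qed

text \<open>The \<open>r\<close> crossing points on an edge of a grid are distinct, so they exhaust the edge.\<close>

lemma grid_points:
  assumes g: "is_grid r A B" and A: "\<And>i. i < r \<Longrightarrow> finite (A i) \<and> card (A i) = r"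
  obtains pt where "\<And>i j. \<lbrakk>i < r; j < r\<rbrakk> \<Longrightarrow> A i \<inter> B j = {pt i j}"
    "\<And>i. i < r \<Longrightarrow> inj_on (pt i) {..<r}" "\<And>i. i < r \<Longrightarrow> A i = pt i ` {..<r}"
proof -
  define pt where "pt = (\<lambda>i j. the_elem (A i \<inter> B j))"
  have pt: "A i \<inter> B j = {pt i j}" if "i < r" "j < r" for i j
  proof -
    have "card (A i \<inter> B j) = 1" using g that unfolding is_grid_def by blast
    then obtain z where "A i \<inter> B j = {z}" by (auto simp: card_1_singleton_iff)
    then show ?thesis by (simp add: pt_def)
  qed
  have inj: "inj_on (pt i) {..<r}" if "i < r" for i
  proof (rule inj_onI)
    fix j j' assume h: "j \<in> {..<r}" "j' \<in> {..<r}" "pt i j = pt i j'"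
    then have "A i \<inter> B j = {pt i j}" "A i \<inter> B j' = {pt i j}" using pt that by simp_all
    then have "pt i j \<in> B j \<inter> B j'" by blast
    then show "j = j'" using g h unfolding is_grid_def by blast
  qed
  have "A i = pt i ` {..<r}" if "i < r" for i
  proof (rule card_subset_eq[symmetric])
    show "pt i ` {..<r} \<subseteq> A i" using pt that by blast
    show "card (pt i ` {..<r}) = card (A i)" using inj[OF that] A[OF that] by (simp add: card_image)
  qed (use A that in blast)
  then show ?thesis using that pt inj by blast
qed

text \<open>Used for the matrix of columns in which the points of a grid lie: a line of the construction
  visits all \<open>r\<close> columns once, while an edge inside a column stays there. A constant row next to an injective row of
  \<open>r\<close> values repeats its value in some column, which is therefore constant too; this rigidity leaves five patterns.\<close>

lemma matrix_cases:
  fixes c :: "nat \<Rightarrow> nat \<Rightarrow> nat"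
  assumes c': "\<forall>i<r. \<forall>j<r. c i j < r" and r: "0 < r"
    and row': "\<forall>i<r. inj_on (c i) {..<r} \<or> (\<exists>k. \<forall>j<r. c i j = k)"
    and col': "\<forall>j<r. inj_on (\<lambda>i. c i j) {..<r} \<or> (\<exists>k. \<forall>i<r. c i j = k)"
  obtains (latin) "\<And>i. i < r \<Longrightarrow> inj_on (c i) {..<r}" "latin_square r c"
  | (const) k where "\<And>i j. \<lbrakk>i < r; j < r\<rbrakk> \<Longrightarrow> c i j = k"
  | (rows) "\<And>i. i < r \<Longrightarrow> \<exists>k. \<forall>j<r. c i j = k" "\<And>j. j < r \<Longrightarrow> inj_on (\<lambda>i. c i j) {..<r}"
  | (columns) "\<And>j. j < r \<Longrightarrow> \<exists>k. \<forall>i<r. c i j = k" "\<And>i. i < r \<Longrightarrow> inj_on (c i) {..<r}"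
  | (cross) i0 j0 k where "i0 < r" "j0 < r" "\<And>j. j < r \<Longrightarrow> c i0 j = k" "\<And>i. i < r \<Longrightarrow> c i j0 = k"
      "\<And>i. \<lbrakk>i < r; i \<noteq> i0\<rbrakk> \<Longrightarrow> inj_on (c i) {..<r}"
      "\<And>j. \<lbrakk>j < r; j \<noteq> j0\<rbrakk> \<Longrightarrow> inj_on (\<lambda>i. c i j) {..<r}"
proof -
  note c = c'[rule_format] and row = row'[rule_format] and col = col'[rule_format]
  define Rc where "Rc = {i. i < r \<and> (\<exists>k. \<forall>j<r. c i j = k)}"
  define Cc where "Cc = {j. j < r \<and> (\<exists>k. \<forall>i<r. c i j = k)}"
  have surj: "c i ` {..<r} = {..<r}" if "i < r" "inj_on (c i) {..<r}" for i
    using that c by (intro endo_inj_surj) auto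
  have surj': "(\<lambda>i. c i j) ` {..<r} = {..<r}" if "j < r" "inj_on (\<lambda>i. c i j) {..<r}" for j
    using that c by (intro endo_inj_surj) auto
  have R: "inj_on (c i) {..<r}" if "i < r" "i \<notin> Rc" for i 
    using row[OF that(1)] that unfolding Rc_def by blast
  have C: "inj_on (\<lambda>i. c i j) {..<r}" if "j < r" "j \<notin> Cc" for j 
    using col[OF that(1)] that unfolding Cc_def by blast
  show thesis
  proof (cases "Rc = {}"; cases "Cc = {}")
    assume e: "Rc = {}" "Cc = {}"
    then have "latin_square r c" using R C c by unfold_locales auto
    then show thesis using latin R e by blast
  next
    assume e: "Rc = {}" "Cc \<noteq> {}"
    obtain j where j: "j \<in> Cc" using e by blast
    then obtain k where k: "j < r" "\<And>i. i < r \<Longrightarrow> c i j = k" unfolding Cc_def by blast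
    have "j' \<in> Cc" if j': "j' < r" for j'
    proof (rule ccontr)
      assume n: "j' \<notin> Cc"
      have "k < r" using k c r by metis
      then obtain i where i: "i < r" "c i j' = k" using surj'[OF j' C[OF j' n]] by (metis imageE lessThan_iff)
      then have "j = j'" using R[of i] e k j' by (auto simp: inj_on_def)
      then show False using n j by simp
    qed
    then show thesis using columns R e unfolding Cc_def by blast
  next
    assume e: "Rc \<noteq> {}" "Cc = {}"
    obtain i where i: "i \<in> Rc" using e by blast
    then obtain k where k: "i < r" "\<And>j. j < r \<Longrightarrow> c i j = k" unfolding Rc_def by blast
    have "i' \<in> Rc" if i': "i' < r" for i'
    proof (rule ccontr)
      assume n: "i' \<notin> Rc"
      have "k < r" using k c r by metis
      then obtain j where j: "j < r" "c i' j = k" using surj[OF i' R[OF i' n]] by (metis imageE lessThan_iff)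
      then have "i = i'" using C[of j] e k i' by (auto simp: inj_on_def)
      then show False using n i by simp
    qed
    then show thesis using rows C e unfolding Rc_def by blast
  next
    assume e: "Rc \<noteq> {}" "Cc \<noteq> {}"
    obtain i0 j0 where ij: "i0 \<in> Rc" "j0 \<in> Cc" using e by blast
    define k where "k = c i0 j0"
    have k: "i0 < r" "j0 < r" "\<And>j. j < r \<Longrightarrow> c i0 j = k" "\<And>i. i < r \<Longrightarrow> c i j0 = k"
      using ij by (auto simp: Rc_def Cc_def k_def)
    show thesis
    proof (cases "Rc = {i0} \<and> Cc = {j0}")
      case True
      then show thesis using cross[OF k] R C by blast
    next
      case False
      have "c i j = k" if "i < r" "j < r" for i j
      proof -
        from False ij consider i1 where "i1 \<in> Rc" "i1 \<noteq> i0" | j1 where "j1 \<in> Cc" "j1 \<noteq> j0" by blast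
        then show ?thesis
        proof cases
          case 1
          then have i1: "i1 < r" "\<And>j. j < r \<Longrightarrow> c i1 j = k"
            using k(2) k(4)[of i1] by (auto simp: Rc_def)
          have "\<not> inj_on (\<lambda>i. c i j) {..<r}"
            using i1 k(1) k(3)[OF that(2)] i1(2)[OF that(2)] 1(2) by (auto simp: inj_on_def)
          then show ?thesis using col[OF that(2)] k that by metis
        next
          case 2
          then have j1: "j1 < r" "\<And>i. i < r \<Longrightarrow> c i j1 = k"
            using k(1) k(3)[of j1] by (auto simp: Cc_def)
          have "\<not> inj_on (c i) {..<r}"
            using j1 k(2) k(4)[OF that(1)] j1(2)[OF that(1)] 2(2) by (auto simp: inj_on_def)
          then show ?thesis using row[OF that(1)] k that by metis
        qed
      qed
      then show thesis using const by blast
    qed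
  qed
qed

section \<open>Lines in columns of residues\<close>

text \<open>The vertices are the points \<open>(k, y)\<close> with \<open>k < r\<close> and \<open>y\<close> a residue modulo \<open>m\<close>. The parameters \<open>(a, b)\<close> give
  the line whose height in column \<open>k\<close> is \<open>a x\<^sub>k + b\<close>. As differences of the \<open>x\<^sub>k\<close> are units, two points in different
  columns determine the line even though \<open>m\<close> need not be prime.\<close>

locale line_system =
  fixes r m :: nat and x :: "nat \<Rightarrow> int"
  assumes r4: "4 \<le> r" and m_pos: "0 < m"
    and direction_diff: "\<lbrakk>k < r; l < r; k \<noteq> l\<rbrakk> \<Longrightarrow> coprime (int m) (x k - x l)"
    and no_latin: "\<lbrakk>latin_square r L;
        \<And>i j. \<lbrakk>i < r; j < r\<rbrakk> \<Longrightarrow>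
          int m dvd (a i * x (L i j) + b i) - (\<alpha> j * x (L i j) + \<beta> j)\<rbrakk>
      \<Longrightarrow> int m dvd a 0 - \<alpha> 0 \<and> int m dvd b 0 - \<beta> 0"
begin

definition parameters :: "(int \<times> int) set" where
  "parameters = {0..<int m} \<times> {0..<int m}"

definition height :: "int \<times> int \<Rightarrow> nat \<Rightarrow> nat" where
  "height p k = nat ((fst p * x k + snd p) mod int m)"

definition line :: "int \<times> int \<Rightarrow> (nat \<times> nat) set" where
  "line p = (\<lambda>k. (k, height p k)) ` {..<r}"

lemma height_less: "height p k < m"
  using m_pos pos_mod_bound[of "int m" "fst p * x k + snd p"] by (simp add: height_def nat_less_iff)

lemma height_eq_iff:
  "height p k = height q k \<longleftrightarrow> int m dvd (fst p * x k + snd p) - (fst q * x k + snd q)"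
  using m_pos by (simp add: height_def eq_nat_nat_iff mod_eq_dvd_iff)

lemma residue_eqI:
  fixes a b :: int
  assumes "a \<in> {0..<int m}" "b \<in> {0..<int m}" "int m dvd a - b"
  shows "a = b"
proof -
  have "a mod int m = b mod int m" using assms(3) by (simp add: mod_eq_dvd_iff)
  then show ?thesis using assms(1,2) by simp
qed

lemma parameters_eqI:
  assumes "p \<in> parameters" "q \<in> parameters" "k < r" "l < r" "k \<noteq> l"
    and "height p k = height q k" "height p l = height q l"
  shows "p = q"
proof -
  have d: "int m dvd (fst p * x k + snd p) - (fst q * x k + snd q)"
    "int m dvd (fst p * x l + snd p) - (fst q * x l + snd q)"
    using assms(6,7) by (simp_all add: height_eq_iff)
  have "int m dvd ((fst p * x k + snd p) - (fst q * x k + snd q))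
      - ((fst p * x l + snd p) - (fst q * x l + snd q))"
    using d by (rule dvd_diff)
  also have "\<dots> = (x k - x l) * (fst p - fst q)" by (simp add: algebra_simps)
  finally have "int m dvd fst p - fst q"
    using direction_diff[OF assms(3-5)] by (simp add: coprime_dvd_mult_right_iff)
  then have f: "fst p = fst q"
    using assms(1,2) by (intro residue_eqI) (auto simp: parameters_def)
  then have "int m dvd snd p - snd q" using d(1) by simp
  then have "snd p = snd q"
    using assms(1,2) by (intro residue_eqI) (auto simp: parameters_def)
  then show ?thesis using f by (simp add: prod_eq_iff)
qed

lemma mem_line: "z \<in> line p \<longleftrightarrow> fst z < r \<and> snd z = height p (fst z)"
  by (cases z) (auto simp: line_def)

lemma card_line: "card (line p) = r" and finite_line: "finite (line p)"
  by (auto simp: line_def card_image inj_on_def)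

lemma line_Int_le_1:
  assumes "p \<in> parameters" "q \<in> parameters" "p \<noteq> q"
  shows "card (line p \<inter> line q) \<le> 1"
proof -
  have "z = w" if "z \<in> line p \<inter> line q" "w \<in> line p \<inter> line q" for z w
  proof -
    have "fst z = fst w"
      using that parameters_eqI[OF assms(1,2), of "fst z" "fst w"] assms(3)
      by (auto simp: mem_line)
    then show ?thesis using that by (auto simp: mem_line prod_eq_iff)
  qed
  then show ?thesis by (simp add: card_le_Suc0_iff_eq finite_line)
qed

lemma inj_line: "inj_on line parameters"
proof (rule inj_onI, rule ccontr)
  fix p q assume "p \<in> parameters" "q \<in> parameters" "line p = line q" "p \<noteq> q"
  then have "card (line p) \<le> 1" using line_Int_le_1[of p q] by simp
  then show False using card_line r4 by simp
qed

lemma card_parameters: "card parameters = m ^ 2" and finite_parameters: "finite parameters"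
  by (simp_all add: parameters_def power2_eq_square)

lemma latin_incidence_trivial:
  assumes L: "latin_square r L" and "p 0 \<in> parameters" "q 0 \<in> parameters"
    and h: "\<And>i j. \<lbrakk>i < r; j < r\<rbrakk> \<Longrightarrow> height (p i) (L i j) = height (q j) (L i j)"
  shows "p 0 = q 0"
proof -
  have "int m dvd fst (p 0) - fst (q 0) \<and> int m dvd snd (p 0) - snd (q 0)"
    by (rule no_latin[OF L]) (use h in \<open>simp add: height_eq_iff\<close>)
  then have "fst (p 0) = fst (q 0)" "snd (p 0) = snd (q 0)"
    using assms(2,3) by (auto intro!: residue_eqI simp: parameters_def)
  then show ?thesis by (simp add: prod_eq_iff)
qed

text \<open>Systems of \<open>r - 1\<close> and \<open>r - 1\<close> lines that could be completed to a grid by two edges inside one common column. For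
  \<open>r = 4\<close> these are grids of three and three lines, which no choice of the \<open>x\<^sub>k\<close> can rule out in general, so they are counted
  instead.\<close>

definition smaller_grids :: "((nat \<Rightarrow> int \<times> int) \<times> (nat \<Rightarrow> int \<times> int)) set" where
  "smaller_grids = {(a, b). a \<in> {..<r - 1} \<rightarrow>\<^sub>E parameters \<and> b \<in> {..<r - 1} \<rightarrow>\<^sub>E parameters \<and>
     (\<exists>M. (\<forall>i<r - 1. \<forall>j<r - 1. M i j < r \<and> height (a i) (M i j) = height (b j) (M i j)) \<and>
       (\<forall>i<r - 1. inj_on (M i) {..<r - 1}) \<and> (\<forall>j<r - 1. inj_on (\<lambda>i. M i j) {..<r - 1}))}"

end

section \<open>Lines together with fillings of the columns\<close>

text \<open>A grid-free linear hypergraph \<open>F\<close> on \<open>m\<close> points is copied into each of the \<open>r\<close> columns, where pairs of points are not yet covered,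
  after an arbitrary permutation \<open>\<Phi> k\<close> of the points of column \<open>k\<close>.\<close>

locale column_filling = line_system +
  fixes F :: "nat set set"
  assumes F_sub: "E \<in> F \<Longrightarrow> E \<subseteq> {..<m}"
    and F_card: "E \<in> F \<Longrightarrow> card E = r"
    and F_linear: "\<lbrakk>E \<in> F; E' \<in> F; E \<noteq> E'\<rbrakk> \<Longrightarrow> card (E \<inter> E') \<le> 1"
    and F_gridfree: "\<not> contains_grid r F"
begin

lemma finite_F: "finite F"
  using F_sub by (intro finite_subset[of F "Pow {..<m}"]) auto

lemma F_finite_edge: "E \<in> F \<Longrightarrow> finite E"
  using F_sub finite_subset by blast

lemma F_inj: assumes "E \<in> F" "E' \<in> F" "v \<in> E" "v \<in> E'" "w \<in> E" "w \<in> E'" "v \<noteq> w"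
  shows "E = E'"
proof (rule ccontr)
  assume "E \<noteq> E'"
  then have "card (E \<inter> E') \<le> 1" using F_linear assms by blast
  then show False using assms F_finite_edge card_le_Suc0_iff_eq[of "E \<inter> E'"] by auto
qed

definition ordered_edges :: "(nat \<Rightarrow> nat) set" where
  "ordered_edges = {z \<in> {..<r} \<rightarrow>\<^sub>E {..<m}. inj_on z {..<r} \<and> z ` {..<r} \<in> F}"

definition edge_pairs :: "(nat set \<times> nat set \<times> (nat \<Rightarrow> nat) \<times> (nat \<Rightarrow> nat)) set" where
  "edge_pairs = {(E, E', z, z'). E \<in> F \<and> E' \<in> F \<and> E \<noteq> E' \<and> E \<inter> E' \<noteq> {} \<and>
     z \<in> {..<r - 1} \<rightarrow>\<^sub>E E \<and> z' \<in> {..<r - 1} \<rightarrow>\<^sub>E E' \<and>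
     inj_on z {..<r - 1} \<and> inj_on z' {..<r - 1} \<and> z ` {..<r - 1} \<inter> z' ` {..<r - 1} = {}}"

definition relabellings :: "(nat \<Rightarrow> nat \<Rightarrow> nat) set" where
  "relabellings = {..<r} \<rightarrow>\<^sub>E {\<phi>. \<phi> permutes {..<m}}"

text \<open>The two ways in which lines and column edges might form a grid. In a stacked grid the \<open>r\<close> edges of one class lie
  one in each column and the other class consists of lines \<open>b\<close>; here \<open>z k\<close> lists the vertices of \<open>F\<close> that \<open>\<Phi> k\<close> places on these lines.
  In a crossed grid each class has one edge inside the same column \<open>k\<close>, and the other \<open>r - 1\<close> edges of each class
  are lines, hitting these two edges in the images of \<open>z\<close> and \<open>z'\<close>.\<close>

definition stacked_conf where
  "stacked_conf = ({..<r} \<rightarrow>\<^sub>E parameters) \<times> ({..<r} \<rightarrow>\<^sub>E ordered_edges)"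

definition stacked where
  "stacked \<Phi> = (\<lambda>(b, z). \<forall>k<r. \<forall>j<r. \<Phi> k (z k j) = height (b j) k)"

definition crossed_conf where
  "crossed_conf = {..<r} \<times> smaller_grids \<times> edge_pairs"

definition crossed where
  "crossed \<Phi> = (\<lambda>(k, (a, b), E, E', z, z').
     (\<forall>i<r - 1. \<Phi> k (z i) = height (a i) k) \<and> (\<forall>j<r - 1. \<Phi> k (z' j) = height (b j) k))"

text \<open>One column edge of every such configuration; removing these edges destroys all mixed grids.\<close>

definition bad where
  "bad \<Phi> = (\<lambda>(b, z). (0, z 0 ` {..<r})) ` {\<tau> \<in> stacked_conf. stacked \<Phi> \<tau>} \<union>
     (\<lambda>(k, (a, b), E, E', z, z'). (k, E)) ` {\<tau> \<in> crossed_conf. crossed \<Phi> \<tau>}"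

definition column_edge :: "(nat \<Rightarrow> nat \<Rightarrow> nat) \<Rightarrow> nat \<times> nat set \<Rightarrow> (nat \<times> nat) set" where
  "column_edge \<Phi> = (\<lambda>(k, E). (\<lambda>v. (k, \<Phi> k v)) ` E)"

definition combined where
  "combined \<Phi> = line ` parameters \<union> column_edge \<Phi> ` ({..<r} \<times> F - bad \<Phi>)"

end

locale relabelled_filling = column_filling +
  fixes \<Phi> :: "nat \<Rightarrow> nat \<Rightarrow> nat"
  assumes relabelling: "\<Phi> \<in> relabellings"
begin

lemma permutes_column: "k < r \<Longrightarrow> \<Phi> k permutes {..<m}"
  using relabelling by (auto simp: relabellings_def PiE_def Pi_def)

lemma inj_column: "k < r \<Longrightarrow> inj (\<Phi> k)"
  using permutes_column permutes_inj by blast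

lemma inj_column_edge_fun: "k < r \<Longrightarrow> inj (\<lambda>v. (k, \<Phi> k v))"
  using inj_column by (auto simp: inj_def)

lemma card_column_edge: "\<lbrakk>k < r; E \<in> F\<rbrakk> \<Longrightarrow> card (column_edge \<Phi> (k, E)) = r"
  using inj_column_edge_fun[of k] F_card
  by (simp add: column_edge_def card_image inj_on_subset)

lemma mem_column_edge: "w \<in> column_edge \<Phi> (k, E) \<longleftrightarrow> fst w = k \<and> (\<exists>v\<in>E. snd w = \<Phi> k v)"
  by (cases w) (auto simp: column_edge_def)

lemma combined_cases:
  assumes "e \<in> combined \<Phi>"
  obtains p where "p \<in> parameters" "e = line p"
  | k E where "k < r" "E \<in> F" "(k, E) \<notin> bad \<Phi>" "e = column_edge \<Phi> (k, E)"
  using assms unfolding combined_def by blast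

lemma combined_sub: "e \<in> combined \<Phi> \<Longrightarrow> e \<subseteq> {..<r} \<times> {..<m}"
proof (erule combined_cases)
  fix p assume "e = line p"
  then show ?thesis by (auto simp: line_def height_less)
next
  fix k E assume h: "k < r" "E \<in> F" "e = column_edge \<Phi> (k, E)"
  show ?thesis
  proof
    fix w assume "w \<in> e"
    then obtain v where v: "fst w = k" "v \<in> E" "snd w = \<Phi> k v" using h by (auto simp: mem_column_edge)
    then have "\<Phi> k v \<in> {..<m}"
      using permutes_in_image[OF permutes_column[OF h(1)], of v] F_sub[OF h(2)] by auto
    then show "w \<in> {..<r} \<times> {..<m}" using v h by (cases w) auto
  qed
qed

lemma combined_card: "e \<in> combined \<Phi> \<Longrightarrow> card e = r" and combined_finite: "e \<in> combined \<Phi> \<Longrightarrow> finite e"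
proof -
  assume e: "e \<in> combined \<Phi>"
  show c: "card e = r" using e card_line card_column_edge by (cases rule: combined_cases) auto
  show "finite e" using c r4 card_ge_0_finite by force
qed

lemma line_column_Int_le_1: "card (line p \<inter> column_edge \<Phi> (k, E)) \<le> 1"
  by (auto simp: card_le_Suc0_iff_eq finite_line mem_line mem_column_edge prod_eq_iff)

lemma combined_linear:
  assumes "e \<in> combined \<Phi>" "e' \<in> combined \<Phi>" "e \<noteq> e'"
  shows "card (e \<inter> e') \<le> 1"
  using assms(1)
proof (cases rule: combined_cases)
  case (1 p0)
  from assms(2) show ?thesis
  proof (cases rule: combined_cases)
    case (1 q)
    then show ?thesis using line_Int_le_1 \<open>p0 \<in> parameters\<close> \<open>e = line p0\<close> assms(3) by blast
  next
    case (2 k E)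
    then show ?thesis using line_column_Int_le_1 \<open>e = line p0\<close> by blast
  qed
next
  case (2 k E)
  from assms(2) show ?thesis
  proof (cases rule: combined_cases)
    case 1 then show ?thesis using 2 line_column_Int_le_1 by (simp add: Int_commute)
  next
    case (2 l E')
    show ?thesis
    proof (cases "k = l")
      case True
      have "e \<inter> e' = (\<lambda>v. (k, \<Phi> k v)) ` (E \<inter> E')"
        using 2 \<open>e = column_edge \<Phi> (k, E)\<close> True image_Int[OF inj_column_edge_fun[of k]] \<open>k < r\<close>
        by (simp add: column_edge_def)
      moreover have "E \<noteq> E'" using 2 \<open>e = column_edge \<Phi> (k, E)\<close> True assms(3) by auto
      ultimately show ?thesis
        using F_linear[OF \<open>E \<in> F\<close> \<open>E' \<in> F\<close>] card_image_le[of "E \<inter> E'" "\<lambda>v. (k, \<Phi> k v)"]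
          F_finite_edge[OF \<open>E \<in> F\<close>] by fastforce
    next
      case False
      then have "e \<inter> e' = {}" using 2 \<open>e = column_edge \<Phi> (k, E)\<close> by (auto simp: mem_column_edge)
      then show ?thesis by simp
    qed
  qed
qed

text \<open>Lines and column edges are never equal, so only the bad edges are lost.\<close>

lemma card_combined:
  assumes "finite (bad \<Phi>)"
  shows "m ^ 2 + r * card F \<le> card (combined \<Phi>) + card (bad \<Phi>)"
proof -
  have "line p \<noteq> column_edge \<Phi> (k, E)" if "k < r" for p k E
  proof
    assume "line p = column_edge \<Phi> (k, E)"
    then have "card (line p) \<le> 1" using line_column_Int_le_1[of p k E] by simp
    then show False using card_line r4 by simp
  qed
  then have disj: "line ` parameters \<inter> column_edge \<Phi> ` ({..<r} \<times> F - bad \<Phi>) = {}" by blast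
  have inj: "inj_on (column_edge \<Phi>) ({..<r} \<times> F)"
  proof (rule inj_onI)
    fix t t' assume h: "t \<in> {..<r} \<times> F" "t' \<in> {..<r} \<times> F" "column_edge \<Phi> t = column_edge \<Phi> t'"
    obtain k E k' E' where t: "t = (k, E)" "t' = (k', E')" by fastforce
    have "E \<noteq> {}" using h(1) t F_card r4 by fastforce
    then obtain v where "v \<in> E" by blast
    then have "(k, \<Phi> k v) \<in> column_edge \<Phi> t" using t by (auto simp: mem_column_edge)
    then have "(k, \<Phi> k v) \<in> column_edge \<Phi> t'" using h(3) by simp
    then have kk: "k = k'" using t by (simp add: mem_column_edge)
    then have "E = E'"
      using h t inj_image_eq_iff[OF inj_column_edge_fun[of k]] by (auto simp: column_edge_def)
    then show "t = t'" using t kk by simp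
  qed
  have fin: "finite ({..<r} \<times> F)" using finite_F by simp
  have "card (combined \<Phi>) = card (line ` parameters) + card (column_edge \<Phi> ` ({..<r} \<times> F - bad \<Phi>))"
    unfolding combined_def using disj fin finite_parameters by (intro card_Un_disjoint) auto
  also have "card (line ` parameters) = m ^ 2" using inj_line card_parameters by (simp add: card_image)
  also have "card (column_edge \<Phi> ` ({..<r} \<times> F - bad \<Phi>)) = card ({..<r} \<times> F - bad \<Phi>)"
    using inj by (intro card_image inj_on_subset[OF inj]) auto
  finally have "card (combined \<Phi>) = m ^ 2 + card ({..<r} \<times> F - bad \<Phi>)" .
  moreover have "card ({..<r} \<times> F) - card (bad \<Phi>) \<le> card ({..<r} \<times> F - bad \<Phi>)"
    using diff_card_le_card_Diff[OF assms] .
  moreover have "card ({..<r} \<times> F) = r * card F" by (simp add: card_cartesian_product)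
  ultimately show ?thesis by simp
qed

end

section \<open>Absence of grids after deletion\<close>

context relabelled_filling
begin

lemma edge_direction:
  assumes e: "e \<in> combined \<Phi>" and f: "inj_on f {..<r}" "f ` {..<r} \<subseteq> e"
  obtains p where "p \<in> parameters" "e = line p" "inj_on (\<lambda>j. fst (f j)) {..<r}"
  | k E where "k < r" "E \<in> F" "(k, E) \<notin> bad \<Phi>" "e = column_edge \<Phi> (k, E)" "\<And>j. j < r \<Longrightarrow> fst (f j) = k"
  using e
proof (cases rule: combined_cases)
  case (1 p)
  have "inj_on (\<lambda>j. fst (f j)) {..<r}"
  proof (rule inj_onI)
    fix i j assume ij: "i \<in> {..<r}" "j \<in> {..<r}" and eq: "fst (f i) = fst (f j)"
    have "f i \<in> line p" "f j \<in> line p" using f(2) 1(2) ij by auto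
    then have "f i = f j" using eq by (auto simp: mem_line prod_eq_iff)
    then show "i = j" using f(1) ij by (auto simp: inj_on_def)
  qed
  then show ?thesis using that(1) 1 by blast
next
  case (2 k E)
  have "fst (f j) = k" if "j < r" for j
  proof -
    have "f j \<in> column_edge \<Phi> (k, E)" using f(2) 2(4) that by auto
    then show ?thesis by (simp add: mem_column_edge)
  qed
  then show ?thesis using that(2) 2 by blast
qed

lemma preimage_in_edge:
  assumes "k < r" "(k, y) \<in> column_edge \<Phi> (k, E)"
  shows "inv (\<Phi> k) y \<in> E"
proof -
  obtain v where "v \<in> E" "y = \<Phi> k v" using assms(2) by (auto simp: mem_column_edge)
  then show ?thesis using inv_f_f[OF inj_column[OF assms(1)]] by simp
qed

lemma column_inverse: "k < r \<Longrightarrow> \<Phi> k (inv (\<Phi> k) y) = y"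
  using permutes_inverses(1)[OF permutes_column] .

text \<open>Pulling the points of the lines back along the permutations yields a stacked configuration whose bad edge is the
  one in column 0.\<close>

lemma no_stacked_grid:
  assumes A: "\<And>i. i < r \<Longrightarrow> A i = column_edge \<Phi> (\<kappa> i, E i)" "\<And>i. i < r \<Longrightarrow> E i \<in> F"
      "\<And>i. i < r \<Longrightarrow> (\<kappa> i, E i) \<notin> bad \<Phi>" "\<And>i. i < r \<Longrightarrow> \<kappa> i < r" "inj_on \<kappa> {..<r}"
    and B: "\<And>j. j < r \<Longrightarrow> B j = line (b j)" "\<And>j. j < r \<Longrightarrow> b j \<in> parameters"
    and g: "is_grid r A B"
  shows False
proof -
  have AB: "(\<kappa> i, height (b j) (\<kappa> i)) \<in> A i" if "i < r" "j < r" for i j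
  proof -
    have "card (A i \<inter> B j) = 1" using g that by (simp add: is_grid_def)
    then obtain w where "w \<in> A i" "w \<in> B j" by (auto simp: card_1_singleton_iff)
    moreover from this have "fst w = \<kappa> i" "snd w = height (b j) (fst w)"
      using A(1) B(1) that by (auto simp: mem_column_edge mem_line)
    ultimately show ?thesis by (metis prod.collapse)
  qed
  have disj: "height (b j) k \<noteq> height (b j') k" if "j < r" "j' < r" "j \<noteq> j'" "k < r" for j j' k
  proof
    assume "height (b j) k = height (b j') k"
    then have "(k, height (b j) k) \<in> B j \<inter> B j'" using B(1) that by (auto simp: mem_line)
    then show False using g that unfolding is_grid_def by blast
  qed
  have "\<kappa> ` {..<r} = {..<r}" using A by (intro endo_inj_surj) auto
  then have surj: "\<exists>i<r. \<kappa> i = k" if "k < r" for k using that by (metis imageE lessThan_iff)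
  define z where "z = (\<lambda>k\<in>{..<r}. \<lambda>j\<in>{..<r}. inv (\<Phi> k) (height (b j) k))"
  have z: "z k ` {..<r} = E i \<and> inj_on (z k) {..<r}" if i: "i < r" "\<kappa> i = k" for i k
  proof -
    have k: "k < r" using A(4) i by auto
    have "z k j \<in> E i" if "j < r" for j
      using preimage_in_edge[OF k, of "height (b j) k" "E i"] AB[OF i(1) that] A(1)[OF i(1)] i that k
      by (simp add: z_def)
    then have sub: "z k ` {..<r} \<subseteq> E i" by auto
    have inj: "inj_on (z k) {..<r}"
    proof (rule inj_onI)
      fix j j' assume h: "j \<in> {..<r}" "j' \<in> {..<r}" "z k j = z k j'"
      then have "\<Phi> k (inv (\<Phi> k) (height (b j) k)) = \<Phi> k (inv (\<Phi> k) (height (b j') k))"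
        using k by (simp add: z_def)
      then have "height (b j) k = height (b j') k" by (simp add: column_inverse[OF k])
      then show "j = j'" using disj[of j j' k] h k by auto
    qed
    have "z k ` {..<r} = E i"
      using sub inj F_card[OF A(2)[OF i(1)]] F_finite_edge[OF A(2)[OF i(1)]]
      by (intro card_subset_eq) (auto simp: card_image)
    then show ?thesis using inj by blast
  qed
  have "z k \<in> ordered_edges" if k: "k < r" for k
  proof -
    obtain i where i: "i < r" "\<kappa> i = k" using surj[OF k] by blast
    have "z k ` {..<r} \<subseteq> {..<m}" using z[OF i] F_sub[OF A(2)[OF i(1)]] by simp
    then have "z k \<in> {..<r} \<rightarrow>\<^sub>E {..<m}" using k by (auto simp: z_def PiE_iff)
    then show ?thesis using z[OF i] A(2)[OF i(1)] by (simp add: ordered_edges_def)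
  qed
  then have "(restrict b {..<r}, z) \<in> stacked_conf"
    using B(2) by (auto simp: stacked_conf_def z_def PiE_iff)
  moreover have "stacked \<Phi> (restrict b {..<r}, z)"
    by (auto simp: stacked_def z_def column_inverse)
  ultimately have "(0, z 0 ` {..<r}) \<in> bad \<Phi>" unfolding bad_def by (intro UnI1) (force intro: rev_image_eqI)
  moreover obtain i where i: "i < r" "\<kappa> i = 0" using surj[of 0] r4 by auto
  ultimately show False using A(3)[OF i(1)] z[OF i] i(2) by simp
qed

text \<open>The rows other than \<open>i0\<close> and the columns other than \<open>j0\<close> of the grid form a member of \<^const>\<open>smaller_grids\<close>. Its row
  lines meet the column edge \<open>B j0\<close> and its column lines meet \<open>A i0\<close>; this is a crossed configuration with bad edge \<open>E\<close>.\<close>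

lemma no_crossed_grid:
  assumes g: "is_grid r A B" and ij: "i0 < r" "j0 < r"
    and A: "\<And>i. \<lbrakk>i < r; i \<noteq> i0\<rbrakk> \<Longrightarrow> A i = line (a i) \<and> a i \<in> parameters"
    and B: "\<And>j. \<lbrakk>j < r; j \<noteq> j0\<rbrakk> \<Longrightarrow> B j = line (b j) \<and> b j \<in> parameters"
    and AB0: "A i0 = column_edge \<Phi> (k, E')" "B j0 = column_edge \<Phi> (k, E)" "E \<in> F" "E' \<in> F"
      "(k, E) \<notin> bad \<Phi>" "k < r"
    and c: "\<And>i j. \<lbrakk>i < r; j < r\<rbrakk> \<Longrightarrow> c i j < r \<and> A i \<inter> B j = {(c i j, d i j)}"
    and inj: "\<And>i. \<lbrakk>i < r; i \<noteq> i0\<rbrakk> \<Longrightarrow> inj_on (c i) {..<r}"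
      "\<And>j. \<lbrakk>j < r; j \<noteq> j0\<rbrakk> \<Longrightarrow> inj_on (\<lambda>i. c i j) {..<r}"
  shows False
proof -
  have "\<exists>\<rho>. bij_betw \<rho> {..<r - 1} ({..<r} - {t})" if "t < r" for t
  proof (rule finite_same_card_bij)
    show "card {..<r - 1} = card ({..<r} - {t})" using that by simp
  qed simp_all
  from this[OF ij(1)] this[OF ij(2)] obtain \<rho> \<sigma> where bij: "bij_betw \<rho> {..<r - 1} ({..<r} - {i0})" "bij_betw \<sigma> {..<r - 1} ({..<r} - {j0})"
    by blast
  have \<rho>: "\<rho> i < r" "\<rho> i \<noteq> i0" if "i < r - 1" for i using bij(1) that by (auto simp: bij_betw_def)
  have \<sigma>: "\<sigma> j < r" "\<sigma> j \<noteq> j0" if "j < r - 1" for j using bij(2) that by (auto simp: bij_betw_def)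
  have inj\<rho>: "inj_on \<rho> {..<r - 1}" "inj_on \<sigma> {..<r - 1}" using bij by (auto simp: bij_betw_def)
  have disjA: "A i \<inter> A i' = {}" if "i < r" "i' < r" "i \<noteq> i'" for i i' using g that by (auto simp: is_grid_def)
  have disjB: "B i \<inter> B i' = {}" if "i < r" "i' < r" "i \<noteq> i'" for i i' using g that by (auto simp: is_grid_def)
  define a' where "a' = (\<lambda>i\<in>{..<r - 1}. a (\<rho> i))"
  define b' where "b' = (\<lambda>j\<in>{..<r - 1}. b (\<sigma> j))"
  define M where "M = (\<lambda>i j. c (\<rho> i) (\<sigma> j))"
  have "M i j < r" "height (a' i) (M i j) = height (b' j) (M i j)"
    if i: "i < r - 1" and j: "j < r - 1" for i j
  proof -
    show "M i j < r" using c[OF \<rho>(1)[OF i] \<sigma>(1)[OF j]] by (simp add: M_def)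
    have "(M i j, d (\<rho> i) (\<sigma> j)) \<in> A (\<rho> i) \<inter> B (\<sigma> j)"
      using c[OF \<rho>(1)[OF i] \<sigma>(1)[OF j]] by (simp add: M_def)
    then show "height (a' i) (M i j) = height (b' j) (M i j)"
      using A[OF \<rho>[OF i]] B[OF \<sigma>[OF j]] i j by (simp add: mem_line a'_def b'_def)
  qed
  moreover have "inj_on (M i) {..<r - 1}" if i: "i < r - 1" for i
  proof -
    have "\<sigma> ` {..<r - 1} \<subseteq> {..<r}" using \<sigma>(1) by auto
    then have "inj_on (c (\<rho> i) \<circ> \<sigma>) {..<r - 1}"
      by (intro comp_inj_on[OF inj\<rho>(2)] inj_on_subset[OF inj(1)[OF \<rho>[OF i]]])
    then show ?thesis by (simp add: M_def comp_def)
  qed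
  moreover have "inj_on (\<lambda>i. M i j) {..<r - 1}" if j: "j < r - 1" for j
  proof -
    have "\<rho> ` {..<r - 1} \<subseteq> {..<r}" using \<rho>(1) by auto
    then have "inj_on ((\<lambda>i. c i (\<sigma> j)) \<circ> \<rho>) {..<r - 1}"
      by (intro comp_inj_on[OF inj\<rho>(1)] inj_on_subset[OF inj(2)[OF \<sigma>[OF j]]])
    then show ?thesis by (simp add: M_def comp_def)
  qed
  moreover have "a' \<in> {..<r - 1} \<rightarrow>\<^sub>E parameters" "b' \<in> {..<r - 1} \<rightarrow>\<^sub>E parameters"
    using A[OF \<rho>] B[OF \<sigma>] by (simp_all add: a'_def b'_def PiE_iff)
  ultimately have "(a', b') \<in> smaller_grids" unfolding smaller_grids_def by blast
  define z where "z = (\<lambda>i\<in>{..<r - 1}. inv (\<Phi> k) (height (a' i) k))"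
  define z' where "z' = (\<lambda>j\<in>{..<r - 1}. inv (\<Phi> k) (height (b' j) k))"
  have zA: "(k, \<Phi> k (z i)) \<in> A (\<rho> i) \<inter> B j0" if i: "i < r - 1" for i
  proof -
    have w: "(c (\<rho> i) j0, d (\<rho> i) j0) \<in> A (\<rho> i) \<inter> B j0" using c[OF \<rho>(1)[OF i] ij(2)] by simp
    then have "c (\<rho> i) j0 = k" "d (\<rho> i) j0 = height (a' i) (c (\<rho> i) j0)"
      using AB0(2) A[OF \<rho>[OF i]] i by (auto simp: mem_column_edge mem_line a'_def)
    then show ?thesis using w i column_inverse[OF AB0(6)] by (simp add: z_def)
  qed
  have zB: "(k, \<Phi> k (z' j)) \<in> A i0 \<inter> B (\<sigma> j)" if j: "j < r - 1" for j
  proof -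
    have w: "(c i0 (\<sigma> j), d i0 (\<sigma> j)) \<in> A i0 \<inter> B (\<sigma> j)" using c[OF ij(1) \<sigma>(1)[OF j]] by simp
    then have "c i0 (\<sigma> j) = k" "d i0 (\<sigma> j) = height (b' j) (c i0 (\<sigma> j))"
      using AB0(1) B[OF \<sigma>[OF j]] j by (auto simp: mem_column_edge mem_line b'_def)
    then show ?thesis using w j column_inverse[OF AB0(6)] by (simp add: z'_def)
  qed
  have mem: "v \<in> X" if "(k, \<Phi> k v) \<in> column_edge \<Phi> (k, X)" for v X
    using preimage_in_edge[OF AB0(6) that] inv_f_f[OF inj_column[OF AB0(6)]] by simp
  have zE: "z i \<in> E" "z' i \<in> E'" if "i < r - 1" for i
    using mem zA[OF that] zB[OF that] AB0(1,2) by auto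
  have "E \<noteq> E'"
  proof
    assume "E = E'"
    then have "A i0 \<inter> B j0 = A i0" using AB0 by simp
    then have "card (A i0) = 1" using g ij unfolding is_grid_def by metis
    then show False using card_column_edge[OF AB0(6,4)] AB0(1) r4 by simp
  qed
  moreover have "E \<inter> E' \<noteq> {}"
  proof -
    have w: "(c i0 j0, d i0 j0) \<in> A i0 \<inter> B j0" using c[OF ij] by simp
    then have "c i0 j0 = k" using AB0(1) by (auto simp: mem_column_edge)
    then have "inv (\<Phi> k) (d i0 j0) \<in> E \<inter> E'"
      using w AB0 preimage_in_edge[OF AB0(6)] by auto
    then show ?thesis by blast
  qed
  moreover have "inj_on z {..<r - 1}"
  proof (rule inj_onI)
    fix i i' assume h: "i \<in> {..<r - 1}" "i' \<in> {..<r - 1}" "z i = z i'"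
    then have "(k, \<Phi> k (z i)) \<in> A (\<rho> i) \<inter> A (\<rho> i')" using zA[of i] zA[of i'] by auto
    then have "\<rho> i = \<rho> i'" using disjA \<rho>(1) h by blast
    then show "i = i'" using inj\<rho>(1) h by (auto simp: inj_on_def)
  qed
  moreover have "inj_on z' {..<r - 1}"
  proof (rule inj_onI)
    fix i i' assume h: "i \<in> {..<r - 1}" "i' \<in> {..<r - 1}" "z' i = z' i'"
    then have "(k, \<Phi> k (z' i)) \<in> B (\<sigma> i) \<inter> B (\<sigma> i')" using zB[of i] zB[of i'] by auto
    then have "\<sigma> i = \<sigma> i'" using disjB \<sigma>(1) h by blast
    then show "i = i'" using inj\<rho>(2) h by (auto simp: inj_on_def)
  qed
  moreover have "z ` {..<r - 1} \<inter> z' ` {..<r - 1} = {}"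
  proof -
    have "z i \<noteq> z' j" if "i < r - 1" "j < r - 1" for i j
      using zA[OF that(1)] zB[OF that(2)] disjA[OF \<rho>(1)[OF that(1)] ij(1) \<rho>(2)[OF that(1)]]
      by (metis Int_iff empty_iff)
    then show ?thesis by blast
  qed
  ultimately have "(E, E', z, z') \<in> edge_pairs"
    using AB0 zE by (simp add: edge_pairs_def PiE_iff z_def z'_def)
  then have "(k, (a', b'), E, E', z, z') \<in> crossed_conf"
    using \<open>(a', b') \<in> smaller_grids\<close> AB0(6) by (simp add: crossed_conf_def)
  moreover have "crossed \<Phi> (k, (a', b'), E, E', z, z')"
    using column_inverse[OF AB0(6)] by (simp add: crossed_def z_def z'_def)
  ultimately have "(k, E) \<in> bad \<Phi>" unfolding bad_def by (intro UnI2) (force intro: rev_image_eqI)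
  then show False using AB0 by simp
qed

text \<open>The five patterns of \<open>matrix_cases\<close>, applied to the columns of the points of a grid: all edges are lines, and they
  realise a Latin square; all edges lie in one column and form a grid in \<open>F\<close>; one class lies inside columns, in two symmetric cases;
  or each class has exactly one edge inside a column.\<close>

lemma combined_gridfree: "\<not> contains_grid r (combined \<Phi>)"
proof
  assume "contains_grid r (combined \<Phi>)"
  then obtain A B where g: "is_grid r A B"
    and AH: "\<And>i. i < r \<Longrightarrow> A i \<in> combined \<Phi>" and BH: "\<And>j. j < r \<Longrightarrow> B j \<in> combined \<Phi>"
    using contains_gridE by blast
  obtain pt where pt: "\<And>i j. \<lbrakk>i < r; j < r\<rbrakk> \<Longrightarrow> A i \<inter> B j = {pt i j}"
    "\<And>i. i < r \<Longrightarrow> inj_on (pt i) {..<r}" "\<And>i. i < r \<Longrightarrow> A i = pt i ` {..<r}"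
    using grid_points[OF g] combined_card[OF AH] combined_finite[OF AH] by blast
  obtain pt' where pt': "\<And>j i. \<lbrakk>j < r; i < r\<rbrakk> \<Longrightarrow> B j \<inter> A i = {pt' j i}"
    "\<And>j. j < r \<Longrightarrow> inj_on (pt' j) {..<r}" "\<And>j. j < r \<Longrightarrow> B j = pt' j ` {..<r}"
    using grid_points[OF is_grid_swap[OF g]] combined_card[OF BH] combined_finite[OF BH] by blast
  have eq: "pt' j i = pt i j" if "i < r" "j < r" for i j
    using pt(1)[OF that] pt'(1)[OF that(2,1)] by (simp add: Int_commute)
  define c where "c = (\<lambda>i j. fst (pt i j))"
  have cd: "c i j < r \<and> A i \<inter> B j = {(c i j, snd (pt i j))}" if "i < r" "j < r" for i j
  proof -
    have "pt i j \<in> A i" using pt(1)[OF that] by blast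
    then have "pt i j \<in> {..<r} \<times> {..<m}" using combined_sub[OF AH[OF that(1)]] by blast
    then show ?thesis using pt(1)[OF that] by (auto simp: c_def)
  qed
  have eqc: "fst (pt' j i) = c i j" if "i < r" "j < r" for i j using eq[OF that] by (simp add: c_def)
  have r0: "0 < r" "1 < r" using r4 by auto
  have not_both: "\<not> (inj_on f {..<r} \<and> (\<forall>j<r. f j = k))" for f :: "nat \<Rightarrow> nat" and k
  proof
    assume "inj_on f {..<r} \<and> (\<forall>j<r. f j = k)"
    then have "f 0 = f 1" "inj_on f {..<r}" using r0 by auto
    then show False using r0 by (auto simp: inj_on_def)
  qed
  have Arow: "(\<exists>p\<in>parameters. A i = line p \<and> inj_on (c i) {..<r}) \<or>
      (\<exists>k E. k < r \<and> E \<in> F \<and> (k, E) \<notin> bad \<Phi> \<and> A i = column_edge \<Phi> (k, E) \<and> (\<forall>j<r. c i j = k))"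
    if i: "i < r" for i
  proof -
    have sub: "pt i ` {..<r} \<subseteq> A i" using pt(3)[OF i] by simp
    show ?thesis
      using edge_direction[OF AH[OF i] pt(2)[OF i] sub] unfolding c_def by metis
  qed
  have Bcol: "(\<exists>p\<in>parameters. B j = line p \<and> inj_on (\<lambda>i. c i j) {..<r}) \<or>
      (\<exists>k E. k < r \<and> E \<in> F \<and> (k, E) \<notin> bad \<Phi> \<and> B j = column_edge \<Phi> (k, E) \<and> (\<forall>i<r. c i j = k))"
    if j: "j < r" for j
  proof -
    have sub: "pt' j ` {..<r} \<subseteq> B j" using pt'(3)[OF j] by simp
    have "inj_on (\<lambda>i. fst (pt' j i)) {..<r} \<longleftrightarrow> inj_on (\<lambda>i. c i j) {..<r}"
      by (rule inj_on_cong) (use eqc j in auto)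
    then show ?thesis
      using edge_direction[OF BH[OF j] pt'(2)[OF j] sub] eqc j by metis
  qed
  have Aline: "\<exists>p\<in>parameters. A i = line p" if "i < r" "inj_on (c i) {..<r}" for i
    using Arow[OF that(1)] that(2) not_both by blast
  have Bline: "\<exists>p\<in>parameters. B j = line p" if "j < r" "inj_on (\<lambda>i. c i j) {..<r}" for j
    using Bcol[OF that(1)] that(2) not_both by blast
  have Acolumn: "\<exists>E\<in>F. k < r \<and> (k, E) \<notin> bad \<Phi> \<and> A i = column_edge \<Phi> (k, E)"
    if "i < r" "\<And>j. j < r \<Longrightarrow> c i j = k" for i k
    using Arow[OF that(1)] that(2) not_both r0 by metis
  have Bcolumn: "\<exists>E\<in>F. k < r \<and> (k, E) \<notin> bad \<Phi> \<and> B j = column_edge \<Phi> (k, E)"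
    if "j < r" "\<And>i. i < r \<Longrightarrow> c i j = k" for j k
    using Bcol[OF that(1)] that(2) not_both r0 by metis
  have rowc: "\<forall>i<r. inj_on (c i) {..<r} \<or> (\<exists>k. \<forall>j<r. c i j = k)"
    using Arow by blast
  have colc: "\<forall>j<r. inj_on (\<lambda>i. c i j) {..<r} \<or> (\<exists>k. \<forall>i<r. c i j = k)"
    using Bcol by blast
  have cr: "\<forall>i<r. \<forall>j<r. c i j < r" using cd by blast
  from cr r0(1) rowc colc show False
  proof (cases rule: matrix_cases[of r c])
    case latin
    interpret L: latin_square r c using latin(2) .
    obtain p where p: "\<And>i. i < r \<Longrightarrow> p i \<in> parameters \<and> A i = line (p i)"
      using Aline latin(1) by metis
    obtain q where q: "\<And>j. j < r \<Longrightarrow> q j \<in> parameters \<and> B j = line (q j)"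
      using Bline L.column_inj by metis
    have "height (p i) (c i j) = height (q j) (c i j)" if "i < r" "j < r" for i j
    proof -
      have "(c i j, snd (pt i j)) \<in> A i \<inter> B j" using cd[OF that] by simp
      then show ?thesis using p[OF that(1)] q[OF that(2)] by (simp add: mem_line)
    qed
    then have "p 0 = q 0" using latin_incidence_trivial[OF latin(2), of p q] p q r0 by blast
    then have "A 0 \<inter> B 0 = line (p 0)" using p q r0 by simp
    then have "card (line (p 0)) = 1" using g r0 unfolding is_grid_def by metis
    then show False using card_line r4 by simp
  next
    case (const k)
    obtain EA where EA: "\<And>i. i < r \<Longrightarrow> EA i \<in> F \<and> A i = column_edge \<Phi> (k, EA i)" and k: "k < r"
    proof -
      have *: "\<exists>E. E \<in> F \<and> k < r \<and> A i = column_edge \<Phi> (k, E)" if "i < r" for i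
        using Acolumn[OF that const[OF that]] by blast
      then have "k < r" using r0 by blast
      then show ?thesis using that * by metis
    qed
    obtain EB where EB: "\<And>j. j < r \<Longrightarrow> EB j \<in> F \<and> B j = column_edge \<Phi> (k, EB j)"
    proof -
      have "\<exists>E. E \<in> F \<and> B j = column_edge \<Phi> (k, E)" if "j < r" for j
        using Bcolumn[OF that const[OF _ that]] by blast
      then show ?thesis using that by metis
    qed
    let ?h = "\<lambda>v. (k, \<Phi> k v)"
    have "contains_grid r ((`) ?h ` F)"
    proof (rule contains_gridI[OF g])
      show "A i \<in> (`) ?h ` F" "B i \<in> (`) ?h ` F" if "i < r" for i
        using EA[OF that] EB[OF that] by (auto simp: column_edge_def)
      show "card e = r" if "e \<in> (`) ?h ` F" for e
        using that card_column_edge[OF k] by (auto simp: column_edge_def)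
    qed (use r4 in simp)
    then have "contains_grid r F"
      by (rule contains_grid_inj_image[of _ _ _ UNIV]) (use inj_column_edge_fun[OF k] F_card r4 in auto)
    then show False using F_gridfree by simp
  next
    case rows
    obtain \<kappa> where \<kappa>: "\<And>i j. \<lbrakk>i < r; j < r\<rbrakk> \<Longrightarrow> c i j = \<kappa> i" using rows(1) by metis
    obtain E where E: "\<And>i. i < r \<Longrightarrow> E i \<in> F \<and> \<kappa> i < r \<and> (\<kappa> i, E i) \<notin> bad \<Phi> \<and> A i = column_edge \<Phi> (\<kappa> i, E i)"
    proof -
      have "\<exists>E. E \<in> F \<and> \<kappa> i < r \<and> (\<kappa> i, E) \<notin> bad \<Phi> \<and> A i = column_edge \<Phi> (\<kappa> i, E)" if "i < r" for i
        using Acolumn[OF that \<kappa>[OF that]] by blast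
      then show ?thesis using that by metis
    qed
    obtain b where b: "\<And>j. j < r \<Longrightarrow> b j \<in> parameters \<and> B j = line (b j)"
      using Bline rows(2) by metis
    have "inj_on \<kappa> {..<r}" using rows(2)[OF r0(1)] \<kappa>[OF _ r0(1)] by (simp add: inj_on_def)
    then show False using no_stacked_grid[of A \<kappa> E B b] E b g by blast
  next
    case columns
    obtain \<kappa> where \<kappa>: "\<And>i j. \<lbrakk>i < r; j < r\<rbrakk> \<Longrightarrow> c i j = \<kappa> j" using columns(1) by metis
    obtain E where E: "\<And>i. i < r \<Longrightarrow> E i \<in> F \<and> \<kappa> i < r \<and> (\<kappa> i, E i) \<notin> bad \<Phi> \<and> B i = column_edge \<Phi> (\<kappa> i, E i)"
    proof -
      have "\<exists>E. E \<in> F \<and> \<kappa> j < r \<and> (\<kappa> j, E) \<notin> bad \<Phi> \<and> B j = column_edge \<Phi> (\<kappa> j, E)" if "j < r" for j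
        using Bcolumn[OF that \<kappa>[OF _ that]] by blast
      then show ?thesis using that by metis
    qed
    obtain a where a: "\<And>j. j < r \<Longrightarrow> a j \<in> parameters \<and> A j = line (a j)"
      using Aline columns(2) by metis
    have "inj_on \<kappa> {..<r}" using columns(2)[OF r0(1)] \<kappa>[OF r0(1)] by (simp add: inj_on_def)
    then show False using no_stacked_grid[of B \<kappa> E A a] E a is_grid_swap[OF g] by blast
  next
    case (cross i0 j0 k)
    obtain E' where E': "E' \<in> F" "k < r" "A i0 = column_edge \<Phi> (k, E')"
      using Acolumn[OF cross(1) cross(3)] by blast
    obtain E where E: "E \<in> F" "(k, E) \<notin> bad \<Phi>" "B j0 = column_edge \<Phi> (k, E)"
      using Bcolumn[OF cross(2) cross(4)] by blast
    obtain a where a: "\<And>i. \<lbrakk>i < r; i \<noteq> i0\<rbrakk> \<Longrightarrow> A i = line (a i) \<and> a i \<in> parameters"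
      using Aline cross(5) by metis
    obtain b where b: "\<And>j. \<lbrakk>j < r; j \<noteq> j0\<rbrakk> \<Longrightarrow> B j = line (b j) \<and> b j \<in> parameters"
      using Bline cross(6) by metis
    show False
      by (rule no_crossed_grid[OF g cross(1,2) a b E'(3) E(3,1) E'(1) E(2) E'(2) cd cross(5,6)])
  qed
qed

end

section \<open>The number of deleted edges\<close>

text \<open>Such permutations differ from any fixed one by a permutation of \<open>V - Z\<close>.\<close>

lemma card_agreeing_permutations:
  assumes "finite V" "Z \<subseteq> V" and S: "\<And>\<phi>. \<phi> \<in> S \<Longrightarrow> \<phi> permutes V"
    and agree: "\<And>\<phi> \<psi> v. \<lbrakk>\<phi> \<in> S; \<psi> \<in> S; v \<in> Z\<rbrakk> \<Longrightarrow> \<phi> v = \<psi> v"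
  shows "card S \<le> fact (card V - card Z)"
proof (cases "S = {}")
  case False
  then obtain \<phi> where \<phi>: "\<phi> \<in> S" by blast
  let ?P = "{\<tau>. \<tau> permutes (V - Z)}"
  have "S \<subseteq> (\<lambda>\<tau>. \<phi> \<circ> \<tau>) ` ?P"
  proof
    fix \<psi> assume \<psi>: "\<psi> \<in> S"
    have "inv \<phi> \<circ> \<psi> permutes V"
      using S[OF \<phi>] S[OF \<psi>] by (intro permutes_compose permutes_inv)
    moreover have "(inv \<phi> \<circ> \<psi>) v = v" if "v \<in> Z" for v
      using agree[OF \<phi> \<psi> that] permutes_inverses(2)[OF S[OF \<phi>]] by (metis comp_apply)
    ultimately have "inv \<phi> \<circ> \<psi> permutes (V - Z)"
      by (rule permutes_superset) auto
    moreover have "\<psi> = \<phi> \<circ> (inv \<phi> \<circ> \<psi>)"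
      using permutes_inverses(1)[OF S[OF \<phi>]] by (auto simp: fun_eq_iff)
    ultimately show "\<psi> \<in> (\<lambda>\<tau>. \<phi> \<circ> \<tau>) ` ?P" by blast
  qed
  then have "card S \<le> card ((\<lambda>\<tau>. \<phi> \<circ> \<tau>) ` ?P)"
    using assms(1) by (intro card_mono finite_imageI finite_permutations) auto
  also have "\<dots> \<le> card ?P" using assms(1) by (intro card_image_le finite_permutations) auto
  also have "\<dots> = fact (card V - card Z)"
    using assms(1,2) by (intro card_permutations) (auto simp: card_Diff_subset finite_subset)
  finally show ?thesis .
qed simp

text \<open>A random permutation takes prescribed values at \<open>q\<close> points with
  probability at most \<open>(2 / m) ^ q\<close>, provided that \<open>2 * q \<le> m\<close>.\<close>

lemma fact_falling_bound:
  "2 * q \<le> m \<Longrightarrow> fact (m - q) * m ^ q \<le> 2 ^ q * (fact m :: nat)"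
proof (induction q)
  case (Suc q)
  have e: "m - q = Suc (m - Suc q)" using Suc.prems by simp
  have "fact (m - Suc q) * m ^ Suc q = (fact (m - Suc q) * m) * m ^ q" by simp
  also have "\<dots> \<le> (fact (m - Suc q) * (2 * (m - q))) * m ^ q"
    using Suc.prems by (intro mult_le_mono) auto
  also have "\<dots> = 2 * (fact (m - q) * m ^ q)" unfolding e by (simp add: algebra_simps)
  also have "\<dots> \<le> 2 * (2 ^ q * fact m)" using Suc by simp
  finally show ?case by simp
qed simp

lemma double_count:
  assumes "finite \<Omega>" "finite T" "\<And>\<tau>. \<tau> \<in> T \<Longrightarrow> card {\<omega> \<in> \<Omega>. R \<omega> \<tau>} \<le> K"
  shows "(\<Sum>\<omega>\<in>\<Omega>. card {\<tau> \<in> T. R \<omega> \<tau>}) \<le> card T * K"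
proof -
  have "(\<Sum>\<omega>\<in>\<Omega>. card {\<tau> \<in> T. R \<omega> \<tau>}) = (\<Sum>\<omega>\<in>\<Omega>. \<Sum>\<tau>\<in>T. if R \<omega> \<tau> then 1 else 0)"
    by (simp only: card_eq_sum sum.inter_filter[OF assms(2)])
  also have "\<dots> = (\<Sum>\<tau>\<in>T. \<Sum>\<omega>\<in>\<Omega>. if R \<omega> \<tau> then 1 else 0)" by (rule sum.swap)
  also have "\<dots> = (\<Sum>\<tau>\<in>T. card {\<omega> \<in> \<Omega>. R \<omega> \<tau>})"
    by (simp only: card_eq_sum sum.inter_filter[OF assms(1)])
  also have "\<dots> \<le> (\<Sum>\<tau>\<in>T. K)" using assms(3) by (rule sum_mono)
  finally show ?thesis by simp
qed

context line_system
begin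

text \<open>Given the columns \<open>M\<close> of the crossing points, the two lines \<open>a 0\<close> and \<open>a 1\<close> determine two points on every line \<open>b j\<close>;
  then \<open>b 0\<close> and \<open>b 1\<close> determine all lines \<open>a i\<close>. So there are four free residues.\<close>

lemma card_smaller_grids: "card smaller_grids \<le> (r ^ (r - 1)) ^ (r - 1) * m ^ 4"
  and finite_smaller_grids: "finite smaller_grids"
proof -
  let ?I = "{..<r - 1}"
  define Ms where "Ms = ?I \<rightarrow>\<^sub>E (?I \<rightarrow>\<^sub>E {..<r})"
  define G where "G = (\<lambda>M. {(a, b). a \<in> ?I \<rightarrow>\<^sub>E parameters \<and> b \<in> ?I \<rightarrow>\<^sub>E parameters \<and>
     (\<forall>i<r - 1. \<forall>j<r - 1. M i j < r \<and> height (a i) (M i j) = height (b j) (M i j)) \<and>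
     (\<forall>i<r - 1. inj_on (M i) ?I) \<and> (\<forall>j<r - 1. inj_on (\<lambda>i. M i j) ?I)})"
  have sub: "smaller_grids \<subseteq> (\<Union>M\<in>Ms. G M)"
  proof
    fix t assume t: "t \<in> smaller_grids"
    obtain a b where ab: "t = (a, b)" by fastforce
    from t obtain M where M: "a \<in> ?I \<rightarrow>\<^sub>E parameters" "b \<in> ?I \<rightarrow>\<^sub>E parameters"
      "\<forall>i<r - 1. \<forall>j<r - 1. M i j < r \<and> height (a i) (M i j) = height (b j) (M i j)"
      "\<forall>i<r - 1. inj_on (M i) ?I" "\<forall>j<r - 1. inj_on (\<lambda>i. M i j) ?I"
      unfolding smaller_grids_def ab by blast
    let ?M = "\<lambda>i\<in>?I. \<lambda>j\<in>?I. M i j"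
    have "?M \<in> Ms" using M(3) by (simp add: Ms_def PiE_iff)
    moreover have "(a, b) \<in> G ?M"
      using M unfolding G_def by (simp add: inj_on_def)
    ultimately show "t \<in> (\<Union>M\<in>Ms. G M)" using ab by blast
  qed
  have one: "0 < r - 1" "1 < r - 1" using r4 by auto
  have G: "finite (G M) \<and> card (G M) \<le> m ^ 4" for M
  proof -
    let ?f = "\<lambda>(a, b). (a 0, a 1) :: (int \<times> int) \<times> (int \<times> int)"
    have inj: "inj_on ?f (G M)"
    proof (rule inj_onI, clarify)
      fix a b a' b' :: "nat \<Rightarrow> int \<times> int"
      assume g: "(a, b) \<in> G M" "(a', b') \<in> G M" and e: "a 0 = a' 0" "a 1 = a' 1"
      have mem: "a \<in> ?I \<rightarrow>\<^sub>E parameters" "b \<in> ?I \<rightarrow>\<^sub>E parameters" "a' \<in> ?I \<rightarrow>\<^sub>E parameters" "b' \<in> ?I \<rightarrow>\<^sub>E parameters"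
        using g by (auto simp: G_def)
      have h: "M i j < r" "height (a i) (M i j) = height (b j) (M i j)"
        "height (a' i) (M i j) = height (b' j) (M i j)" if "i < r - 1" "j < r - 1" for i j
        using g that by (auto simp: G_def)
      have M: "M 0 j \<noteq> M 1 j" "M j 0 \<noteq> M j 1" if "j < r - 1" for j
      proof -
        have "inj_on (\<lambda>i. M i j) ?I" "inj_on (M j) ?I" using g that by (auto simp: G_def)
        then show "M 0 j \<noteq> M 1 j" "M j 0 \<noteq> M j 1" using one unfolding inj_on_def
          by (metis lessThan_iff zero_neq_one)+
      qed
      have b: "b j = b' j" if "j < r - 1" for j
      proof (rule parameters_eqI)
        show "b j \<in> parameters" "b' j \<in> parameters" using mem that by auto
        show "M 0 j < r" "M 1 j < r" using h(1) one that by blast+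
        show "M 0 j \<noteq> M 1 j" by (rule M[OF that])
        show "height (b j) (M 0 j) = height (b' j) (M 0 j)" "height (b j) (M 1 j) = height (b' j) (M 1 j)"
          using h(2,3)[OF one(1) that] h(2,3)[OF one(2) that] e by simp_all
      qed
      have a: "a j = a' j" if "j < r - 1" for j
      proof (rule parameters_eqI)
        show "a j \<in> parameters" "a' j \<in> parameters" using mem that by auto
        show "M j 0 < r" "M j 1 < r" using h(1) one that by blast+
        show "M j 0 \<noteq> M j 1" by (rule M[OF that])
        show "height (a j) (M j 0) = height (a' j) (M j 0)" "height (a j) (M j 1) = height (a' j) (M j 1)"
          using h(2,3)[OF that one(1)] h(2,3)[OF that one(2)] b[OF one(1)] b[OF one(2)] by simp_all
      qed
      show "a = a' \<and> b = b'" using a b mem by (auto intro!: PiE_ext[of _ ?I])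
    qed
    have im: "?f ` G M \<subseteq> parameters \<times> parameters"
      using one by (auto simp: G_def PiE_iff)
    have fin: "finite (parameters \<times> parameters)" using finite_parameters by simp
    have "card (G M) = card (?f ` G M)" using inj by (simp add: card_image)
    also have "\<dots> \<le> card (parameters \<times> parameters)" using im fin by (rule card_mono[rotated])
    also have "\<dots> = m ^ 4"
      by (simp add: card_cartesian_product card_parameters flip: power_add)
    finally show ?thesis using inj_on_finite[OF inj im fin] by blast
  qed
  have Ms: "finite Ms" "card Ms = (r ^ (r - 1)) ^ (r - 1)"
    by (simp_all add: Ms_def card_PiE finite_PiE)
  have fin: "finite (\<Union>M\<in>Ms. G M)" using Ms G by blast
  then show "finite smaller_grids" using sub by (rule finite_subset[rotated])
  have "card smaller_grids \<le> card (\<Union>M\<in>Ms. G M)" using fin sub by (rule card_mono)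
  also have "\<dots> \<le> (\<Sum>M\<in>Ms. card (G M))" using Ms(1) by (rule card_UN_le)
  also have "\<dots> \<le> (\<Sum>M\<in>Ms. m ^ 4)" using G by (intro sum_mono) blast
  finally show "card smaller_grids \<le> (r ^ (r - 1)) ^ (r - 1) * m ^ 4" using Ms by simp
qed

end

text \<open>The two summands bound the expected numbers of stacked and of crossed configurations, divided by \<open>m\<close>.\<close>

definition bad_constant :: "nat \<Rightarrow> nat" where
  "bad_constant r = (r ^ r * 2 ^ r) ^ r +
     r * ((r ^ (r - 1)) ^ (r - 1) * (r ^ (r - 1)) ^ 2 * 2 ^ (2 * (r - 1)))"

context column_filling
begin

lemma two_vertices:
  assumes "E \<in> F" "v \<in> E" shows "\<exists>w\<in>E. w \<noteq> v"
proof (rule ccontr)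
  assume "\<not> ?thesis"
  then have "E = {v}" using assms by blast
  then show False using F_card[OF assms(1)] r4 by simp
qed

lemma card_F: "card F \<le> m ^ 2"
proof -
  have "\<exists>t. fst t \<in> E \<and> snd t \<in> E \<and> fst t \<noteq> snd t" if "E \<in> F" for E
  proof -
    have "E \<noteq> {}" using F_card[OF that] r4 by auto
    then show ?thesis using two_vertices[OF that] by fastforce
  qed
  then obtain f where f: "\<And>E. E \<in> F \<Longrightarrow> fst (f E) \<in> E \<and> snd (f E) \<in> E \<and> fst (f E) \<noteq> snd (f E)"
    by metis
  have inj: "inj_on f F" by (rule inj_onI) (metis f F_inj)
  have "f ` F \<subseteq> {..<m} \<times> {..<m}"
  proof
    fix t assume "t \<in> f ` F"
    then obtain E where E: "E \<in> F" "t = f E" by blast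
    then show "t \<in> {..<m} \<times> {..<m}" using f[OF E(1)] F_sub[OF E(1)] by (auto simp: mem_Times_iff)
  qed
  then have "card F \<le> card ({..<m} \<times> {..<m})" using inj by (intro card_inj_on_le) auto
  then show ?thesis by (simp add: power2_eq_square)
qed

text \<open>By linearity a pair of intersecting edges is determined by a common vertex together with one more vertex of each edge.\<close>

lemma card_intersecting_pairs:
  "card {(E, E'). E \<in> F \<and> E' \<in> F \<and> E \<inter> E' \<noteq> {}} \<le> m ^ 3" (is "card ?P \<le> _")
proof -
  obtain other where other: "\<And>E v. \<lbrakk>E \<in> F; v \<in> E\<rbrakk> \<Longrightarrow> other E v \<in> E \<and> other E v \<noteq> v"
    using two_vertices by metis
  define common where "common = (\<lambda>t :: nat set \<times> nat set. SOME p. p \<in> fst t \<inter> snd t)"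
  define f where "f = (\<lambda>t. (common t, other (fst t) (common t), other (snd t) (common t)))"
  have f: "fst (f t) \<in> fst t \<and> fst (f t) \<in> snd t \<and> fst (snd (f t)) \<in> fst t \<and>
     fst (snd (f t)) \<noteq> fst (f t) \<and> snd (snd (f t)) \<in> snd t \<and> snd (snd (f t)) \<noteq> fst (f t)"
    if "t \<in> ?P" for t
  proof -
    have t: "fst t \<in> F" "snd t \<in> F" "\<exists>p. p \<in> fst t \<inter> snd t" using that by auto
    have "common t \<in> fst t \<inter> snd t" unfolding common_def by (rule someI_ex[OF t(3)])
    then have c: "common t \<in> fst t" "common t \<in> snd t" by blast+
    show ?thesis using c other[OF t(1) c(1)] other[OF t(2) c(2)] by (simp add: f_def)
  qed
  have mem: "fst t \<in> F" "snd t \<in> F" if "t \<in> ?P" for t using that by auto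
  have inj: "inj_on f ?P"
  proof (rule inj_onI)
    fix s t assume st: "s \<in> ?P" "t \<in> ?P" "f s = f t"
    have "fst s = fst t"
      by (rule F_inj[of _ _ "fst (f s)" "fst (snd (f s))"])
         (use f[OF st(1)] f[OF st(2)] mem[OF st(1)] mem[OF st(2)] st(3) in auto)
    moreover have "snd s = snd t"
      by (rule F_inj[of _ _ "fst (f s)" "snd (snd (f s))"])
         (use f[OF st(1)] f[OF st(2)] mem[OF st(1)] mem[OF st(2)] st(3) in auto)
    ultimately show "s = t" by (simp add: prod_eq_iff)
  qed
  have "f ` ?P \<subseteq> {..<m} \<times> {..<m} \<times> {..<m}"
  proof
    fix y assume "y \<in> f ` ?P"
    then obtain t where t: "t \<in> ?P" "y = f t" by blast
    have "fst t \<subseteq> {..<m}" "snd t \<subseteq> {..<m}" using mem[OF t(1)] F_sub by blast+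
    then show "y \<in> {..<m} \<times> {..<m} \<times> {..<m}" using f[OF t(1)] t(2) by (auto simp: mem_Times_iff)
  qed
  then have "card ?P \<le> card ({..<m} \<times> {..<m} \<times> {..<m})" using inj by (intro card_inj_on_le) auto
  then show ?thesis by (simp add: power3_eq_cube)
qed

lemma card_ordered_edges: "card ordered_edges \<le> r ^ r * m ^ 2" and finite_ordered_edges: "finite ordered_edges"
proof -
  have sub: "ordered_edges \<subseteq> (\<Union>E\<in>F. {..<r} \<rightarrow>\<^sub>E E)"
  proof
    fix z assume z: "z \<in> ordered_edges"
    then have "z \<in> {..<r} \<rightarrow>\<^sub>E z ` {..<r}" "z ` {..<r} \<in> F" by (simp_all add: ordered_edges_def PiE_iff)
    then show "z \<in> (\<Union>E\<in>F. {..<r} \<rightarrow>\<^sub>E E)" by blast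
  qed
  have fin: "finite (\<Union>E\<in>F. {..<r} \<rightarrow>\<^sub>E E)" using finite_F F_finite_edge by (auto intro: finite_PiE)
  then show "finite ordered_edges" using sub by (rule finite_subset[rotated])
  have "card ordered_edges \<le> card (\<Union>E\<in>F. {..<r} \<rightarrow>\<^sub>E E)" using fin sub by (rule card_mono)
  also have "\<dots> \<le> (\<Sum>E\<in>F. card ({..<r} \<rightarrow>\<^sub>E E))" using finite_F by (rule card_UN_le)
  also have "\<dots> = (\<Sum>E\<in>F. r ^ r)" using F_card by (intro sum.cong) (auto simp: card_PiE)
  also have "\<dots> \<le> r ^ r * m ^ 2" using card_F by simp
  finally show "card ordered_edges \<le> r ^ r * m ^ 2" .
qed

lemma card_edge_pairs: "card edge_pairs \<le> m ^ 3 * (r ^ (r - 1)) ^ 2" and finite_edge_pairs: "finite edge_pairs"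
proof -
  define P where "P = {(E, E'). E \<in> F \<and> E' \<in> F \<and> E \<inter> E' \<noteq> {}}"
  define Q :: "nat set \<times> nat set \<Rightarrow> (nat set \<times> nat set \<times> (nat \<Rightarrow> nat) \<times> (nat \<Rightarrow> nat)) set"
    where "Q = (\<lambda>(E, E'). (\<lambda>(z, z'). (E, E', z, z')) ` (({..<r - 1} \<rightarrow>\<^sub>E E) \<times> ({..<r - 1} \<rightarrow>\<^sub>E E')))"
  have P: "finite P" by (rule finite_subset[of _ "F \<times> F"]) (auto simp: P_def finite_F)
  have Q: "finite (Q t) \<and> card (Q t) \<le> (r ^ (r - 1)) ^ 2" if tP: "t \<in> P" for t
  proof -
    obtain E E' where t: "t = (E, E')" "E \<in> F" "E' \<in> F" using tP by (auto simp: P_def)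
    have c: "finite ({..<r - 1} \<rightarrow>\<^sub>E E)" "finite ({..<r - 1} \<rightarrow>\<^sub>E E')"
      "card ({..<r - 1} \<rightarrow>\<^sub>E E) = r ^ (r - 1)" "card ({..<r - 1} \<rightarrow>\<^sub>E E') = r ^ (r - 1)"
      using t F_card F_finite_edge by (auto simp: card_PiE intro: finite_PiE)
    have "card (Q t) \<le> card (({..<r - 1} \<rightarrow>\<^sub>E E) \<times> ({..<r - 1} \<rightarrow>\<^sub>E E'))"
      unfolding Q_def t prod.case using c by (intro card_image_le finite_cartesian_product)
    then show ?thesis using c by (simp add: Q_def t card_cartesian_product power2_eq_square)
  qed
  have sub: "edge_pairs \<subseteq> (\<Union>t\<in>P. Q t)" 
  proof
    fix t assume t: "t \<in> edge_pairs"
    obtain E E' z z' where e: "t = (E, E', z, z')" by (metis prod.collapse)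
    have "(E, E') \<in> P" "t \<in> Q (E, E')" using t by (simp_all add: e edge_pairs_def P_def Q_def)
    then show "t \<in> (\<Union>t\<in>P. Q t)" by blast
  qed
  have fin: "finite (\<Union>t\<in>P. Q t)" using P Q by blast
  then show "finite edge_pairs" using sub by (rule finite_subset[rotated])
  have "card edge_pairs \<le> card (\<Union>t\<in>P. Q t)" using fin sub by (rule card_mono)
  also have "\<dots> \<le> (\<Sum>t\<in>P. card (Q t))" using P by (rule card_UN_le)
  also have "\<dots> \<le> (\<Sum>t\<in>P. (r ^ (r - 1)) ^ 2)" using Q by (intro sum_mono) blast
  also have "\<dots> \<le> m ^ 3 * (r ^ (r - 1)) ^ 2" using card_intersecting_pairs by (simp add: P_def)
  finally show "card edge_pairs \<le> m ^ 3 * (r ^ (r - 1)) ^ 2" .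
qed

lemma finite_relabellings: "finite relabellings" and card_relabellings: "card relabellings = fact m ^ r"
  by (simp_all add: relabellings_def card_PiE finite_PiE finite_permutations card_permutations)

lemma card_stacking_relabellings:
  assumes "\<tau> \<in> stacked_conf"
  shows "card {\<Phi> \<in> relabellings. stacked \<Phi> \<tau>} \<le> fact (m - r) ^ r"
proof -
  obtain b z where \<tau>: "\<tau> = (b, z)" by fastforce
  define S where "S = (\<lambda>k. {\<phi>. \<phi> permutes {..<m} \<and> (\<forall>j<r. \<phi> (z k j) = height (b j) k)})"
  have finS: "finite (S k)" for k
    by (rule finite_subset[OF _ finite_permutations[of "{..<m}"]]) (auto simp: S_def)
  have S: "card (S k) \<le> fact (m - r)" if "k < r" for k
  proof -
    have z: "inj_on (z k) {..<r}" "z k ` {..<r} \<subseteq> {..<m}"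
      using assms that by (auto simp: \<tau> stacked_conf_def ordered_edges_def PiE_iff)
    have "card (S k) \<le> fact (card {..<m} - card (z k ` {..<r}))"
      using z(2) by (intro card_agreeing_permutations) (auto simp: S_def)
    then show ?thesis using z by (simp add: card_image)
  qed
  have "{\<Phi> \<in> relabellings. stacked \<Phi> \<tau>} \<subseteq> PiE {..<r} S"
    by (simp add: subset_iff relabellings_def stacked_def \<tau> S_def PiE_iff)
  then have "card {\<Phi> \<in> relabellings. stacked \<Phi> \<tau>} \<le> card (PiE {..<r} S)"
    using finS by (intro card_mono finite_PiE) auto
  also have "\<dots> = (\<Prod>k<r. card (S k))" by (simp add: card_PiE)
  also have "\<dots> \<le> (\<Prod>k<r. fact (m - r))" using S by (intro prod_mono) auto
  finally show ?thesis by simp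
qed

lemma card_crossing_relabellings:
  assumes "\<tau> \<in> crossed_conf"
  shows "card {\<Phi> \<in> relabellings. crossed \<Phi> \<tau>} \<le> fact (m - 2 * (r - 1)) * fact m ^ (r - 1)"
proof -
  obtain k a b E E' z z' where \<tau>: "\<tau> = (k, (a, b), E, E', z, z')" by (metis prod.collapse)
  let ?I = "{..<r - 1}"
  have k: "k < r" and ep: "(E, E', z, z') \<in> edge_pairs" using assms by (auto simp: \<tau> crossed_conf_def)
  have z: "inj_on z ?I" "inj_on z' ?I" "z ` ?I \<inter> z' ` ?I = {}" "z ` ?I \<subseteq> E" "z' ` ?I \<subseteq> E'" "E \<in> F" "E' \<in> F"
    using ep by (auto simp: edge_pairs_def PiE_iff)
  define T where "T = {\<phi>. \<phi> permutes {..<m} \<and> (\<forall>i<r - 1. \<phi> (z i) = height (a i) k) \<and> (\<forall>j<r - 1. \<phi> (z' j) = height (b j) k)}"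
  define S where "S = (\<lambda>l. if l = k then T else {\<phi>. \<phi> permutes {..<m}})"
  have finS: "finite (S l)" for l
    by (rule finite_subset[OF _ finite_permutations[of "{..<m}"]]) (auto simp: S_def T_def)
  have "card (z ` ?I \<union> z' ` ?I) = 2 * (r - 1)"
    using z by (subst card_Un_disjoint) (auto simp: card_image)
  moreover have "card T \<le> fact (card {..<m} - card (z ` ?I \<union> z' ` ?I))"
  proof (rule card_agreeing_permutations)
    show "z ` ?I \<union> z' ` ?I \<subseteq> {..<m}" using z F_sub by blast
    show "\<phi> v = \<psi> v" if "\<phi> \<in> T" "\<psi> \<in> T" "v \<in> z ` ?I \<union> z' ` ?I" for \<phi> \<psi> v
      using that by (auto simp: T_def)
  qed (auto simp: T_def)
  ultimately have T: "card T \<le> fact (m - 2 * (r - 1))" by simp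
  have "{\<Phi> \<in> relabellings. crossed \<Phi> \<tau>} \<subseteq> PiE {..<r} S"
    using k by (simp add: subset_iff relabellings_def crossed_def \<tau> S_def T_def PiE_iff)
  then have "card {\<Phi> \<in> relabellings. crossed \<Phi> \<tau>} \<le> card (PiE {..<r} S)"
    using finS by (intro card_mono finite_PiE) auto
  also have "\<dots> = (\<Prod>l<r. card (S l))" by (simp add: card_PiE)
  also have "\<dots> = card (S k) * (\<Prod>l\<in>{..<r} - {k}. card (S l))" using k by (intro prod.remove) auto
  also have "(\<Prod>l\<in>{..<r} - {k}. card (S l)) = (\<Prod>l\<in>{..<r} - {k}. fact m)"
    by (rule prod.cong) (auto simp: S_def card_permutations)
  also have "\<dots> = fact m ^ (r - 1)" using k by simp
  finally show ?thesis using T by (simp add: S_def) (meson le_trans mult_le_mono1)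
qed

text \<open>Averaging over all relabellings. A stacked configuration consists of \<open>r\<close> lines and \<open>r\<close> edges, which gives \<open>O(m ^ (4 * r))\<close>
  choices, and prescribes \<open>r * r\<close> values of the permutations; since \<open>r \<ge> 4\<close> the expected number is bounded. A crossed configuration
  has four free residues for the lines and three vertices for the pair of edges, and prescribes \<open>2 * (r - 1) \<ge> 6\<close> values of one
  permutation; the expected number is \<open>O(m)\<close>.\<close>

lemma few_bad_edges:
  assumes m: "4 * r \<le> m"
  obtains \<Phi> where "\<Phi> \<in> relabellings" "finite (bad \<Phi>)" "card (bad \<Phi>) \<le> bad_constant r * m"
proof -
  let ?N = "\<lambda>\<Phi>. card {\<tau> \<in> stacked_conf. stacked \<Phi> \<tau>}" and ?N' = "\<lambda>\<Phi>. card {\<tau> \<in> crossed_conf. crossed \<Phi> \<tau>}"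
  let ?C = "(r ^ r * 2 ^ r) ^ r" and ?C' = "r * ((r ^ (r - 1)) ^ (r - 1) * (r ^ (r - 1)) ^ 2 * 2 ^ (2 * (r - 1)))"
  let ?f = "fact m :: nat"
  have fin: "finite stacked_conf" "finite crossed_conf"
    using finite_parameters finite_ordered_edges finite_smaller_grids finite_edge_pairs
    by (auto simp: stacked_conf_def crossed_conf_def intro!: finite_PiE)
  have m1: "1 \<le> m" using m_pos by simp
  have "card stacked_conf = (m ^ 2) ^ r * card ordered_edges ^ r"
    by (simp add: stacked_conf_def card_cartesian_product card_PiE card_parameters)
  also have "\<dots> \<le> (m ^ 2) ^ r * (r ^ r * m ^ 2) ^ r"
    using card_ordered_edges by (intro mult_le_mono2 power_mono) auto
  finally have "(\<Sum>\<Phi>\<in>relabellings. ?N \<Phi>) \<le> ((m ^ 2) ^ r * (r ^ r * m ^ 2) ^ r) * fact (m - r) ^ r"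
    using double_count[OF finite_relabellings fin(1) card_stacking_relabellings]
    by (meson le_trans mult_le_mono1)
  also have "\<dots> = (r ^ r * (m ^ 4 * fact (m - r))) ^ r"
    by (simp add: power_mult_distrib algebra_simps flip: power_mult power_add)
  also have "\<dots> \<le> (r ^ r * (2 ^ r * ?f)) ^ r"
  proof (intro power_mono mult_le_mono2)
    have "m ^ 4 * fact (m - r) \<le> m ^ r * fact (m - r)"
      using m1 r4 by (intro mult_le_mono1 power_increasing) auto
    also have "\<dots> \<le> 2 ^ r * ?f" using fact_falling_bound[of r m] m by (simp add: mult.commute)
    finally show "m ^ 4 * fact (m - r) \<le> 2 ^ r * ?f" .
  qed auto
  also have "\<dots> = ?C * ?f ^ r" by (simp add: power_mult_distrib algebra_simps)
  also have "\<dots> \<le> ?C * m * ?f ^ r" using m1 by simp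
  finally have S1: "(\<Sum>\<Phi>\<in>relabellings. ?N \<Phi>) \<le> ?C * m * ?f ^ r" .
  have "card crossed_conf = r * (card smaller_grids * card edge_pairs)"
    by (simp add: crossed_conf_def card_cartesian_product)
  also have "\<dots> \<le> r * (((r ^ (r - 1)) ^ (r - 1) * m ^ 4) * (m ^ 3 * (r ^ (r - 1)) ^ 2))"
    using card_smaller_grids card_edge_pairs by (intro mult_le_mono) auto
  finally have "(\<Sum>\<Phi>\<in>relabellings. ?N' \<Phi>) \<le>
      r * (((r ^ (r - 1)) ^ (r - 1) * m ^ 4) * (m ^ 3 * (r ^ (r - 1)) ^ 2)) * (fact (m - 2 * (r - 1)) * ?f ^ (r - 1))"
    using double_count[OF finite_relabellings fin(2) card_crossing_relabellings]
    by (meson le_trans mult_le_mono1)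
  also have "\<dots> = r * ((r ^ (r - 1)) ^ (r - 1) * (r ^ (r - 1)) ^ 2) * m * (m ^ 6 * fact (m - 2 * (r - 1))) * ?f ^ (r - 1)"
    by (simp add: numeral_eq_Suc algebra_simps)
  also have "\<dots> \<le> r * ((r ^ (r - 1)) ^ (r - 1) * (r ^ (r - 1)) ^ 2) * m * (2 ^ (2 * (r - 1)) * ?f) * ?f ^ (r - 1)"
  proof (intro mult_le_mono1 mult_le_mono2)
    have "m ^ 6 * fact (m - 2 * (r - 1)) \<le> m ^ (2 * (r - 1)) * fact (m - 2 * (r - 1))"
      using m1 r4 by (intro mult_le_mono1 power_increasing) auto
    also have "\<dots> \<le> 2 ^ (2 * (r - 1)) * ?f"
      using fact_falling_bound[of "2 * (r - 1)" m] m by (simp add: mult.commute)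
    finally show "m ^ 6 * fact (m - 2 * (r - 1)) \<le> 2 ^ (2 * (r - 1)) * ?f" .
  qed
  also have "\<dots> = ?C' * m * (?f * ?f ^ (r - 1))" by (simp only: mult.assoc mult.left_commute mult.commute)
  also have "?f * ?f ^ (r - 1) = ?f ^ r" using r4 by (simp flip: power_Suc)
  finally have S2: "(\<Sum>\<Phi>\<in>relabellings. ?N' \<Phi>) \<le> ?C' * m * ?f ^ r" .
  have finb: "finite (bad \<Phi>)" for \<Phi> using fin by (simp add: bad_def)
  have "card (bad \<Phi>) \<le> ?N \<Phi> + ?N' \<Phi>" for \<Phi>
  proof -
    have "card (bad \<Phi>) \<le> card ((\<lambda>(b, z). (0 :: nat, z 0 ` {..<r})) ` {\<tau> \<in> stacked_conf. stacked \<Phi> \<tau>}) +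
       card ((\<lambda>(k, (a, b), E, E', z, z'). (k, E)) ` {\<tau> \<in> crossed_conf. crossed \<Phi> \<tau>})"
      unfolding bad_def by (rule card_Un_le)
    also have "\<dots> \<le> ?N \<Phi> + ?N' \<Phi>" using fin by (intro add_mono card_image_le) auto
    finally show ?thesis .
  qed
  then have "(\<Sum>\<Phi>\<in>relabellings. card (bad \<Phi>)) \<le> (\<Sum>\<Phi>\<in>relabellings. ?N \<Phi> + ?N' \<Phi>)"
    by (intro sum_mono)
  also have "\<dots> \<le> (?C * m * ?f ^ r) + (?C' * m * ?f ^ r)" using S1 S2 by (simp add: sum.distrib)
  also have "\<dots> = (bad_constant r * m) * card relabellings"
    by (simp add: bad_constant_def card_relabellings algebra_simps)
  finally have le: "(\<Sum>\<Phi>\<in>relabellings. card (bad \<Phi>)) \<le> (bad_constant r * m) * card relabellings" .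
  have "\<exists>\<Phi>\<in>relabellings. card (bad \<Phi>) \<le> bad_constant r * m"
  proof (rule ccontr)
    assume "\<not> ?thesis"
    then have "(\<Sum>\<Phi>\<in>relabellings. bad_constant r * m) < (\<Sum>\<Phi>\<in>relabellings. card (bad \<Phi>))"
      using finite_relabellings card_relabellings
      by (intro sum_strict_mono) (auto simp: card_gt_0_iff[symmetric] not_le)
    then show False using le by (simp add: mult.commute)
  qed
  then show ?thesis using that finb by blast
qed

end

section \<open>Recursion\<close>

definition packing :: "nat \<Rightarrow> nat \<Rightarrow> nat set set \<Rightarrow> bool" where
  "packing r n F \<longleftrightarrow> (\<forall>e\<in>F. e \<subseteq> {..<n} \<and> card e = r) \<and> linear_hypergraph F \<and> \<not> contains_grid r F"

lemma packing_mono: "packing r m F \<Longrightarrow> m \<le> n \<Longrightarrow> packing r n F"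
  unfolding packing_def by (meson lessThan_subset_iff order_trans)

lemma packing_inj_image:
  assumes h: "inj_on h V" "h ` V \<subseteq> {..<n}" and r: "2 \<le> r"
    and G: "\<And>e. e \<in> G \<Longrightarrow> e \<subseteq> V" "\<And>e. e \<in> G \<Longrightarrow> card e = r"
      "\<And>e e'. \<lbrakk>e \<in> G; e' \<in> G; e \<noteq> e'\<rbrakk> \<Longrightarrow> card (e \<inter> e') \<le> 1" "\<not> contains_grid r G"
  shows "packing r n ((`) h ` G)" "card ((`) h ` G) = card G"
proof -
  have cd: "card (h ` X) = card X" if "X \<subseteq> V" for X
    using inj_on_subset[OF h(1) that] by (rule card_image)
  show "packing r n ((`) h ` G)"
    unfolding packing_def linear_hypergraph_def
  proof (intro conjI ballI impI)
    fix e assume "e \<in> (`) h ` G"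
    then obtain X where X: "X \<in> G" "e = h ` X" by blast
    have "e \<subseteq> h ` V" unfolding X(2) by (intro image_mono G(1) X(1))
    then show "e \<subseteq> {..<n}" using h(2) by (rule order_trans)
    show "card e = r" using cd[OF G(1)[OF X(1)]] G(2)[OF X(1)] X(2) by simp
  next
    fix e e' assume "e \<in> (`) h ` G" "e' \<in> (`) h ` G" and ne: "e \<noteq> e'"
    then obtain X Y where X: "X \<in> G" "e = h ` X" and Y: "Y \<in> G" "e' = h ` Y" by blast
    have "e \<inter> e' = h ` (X \<inter> Y)"
      unfolding X(2) Y(2) by (rule inj_on_image_Int[OF h(1) G(1)[OF X(1)] G(1)[OF Y(1)], symmetric])
    moreover have "card (h ` (X \<inter> Y)) = card (X \<inter> Y)" using G(1)[OF X(1)] by (intro cd) blast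
    ultimately show "card (e \<inter> e') \<le> 1" using G(3)[OF X(1) Y(1)] X Y ne by auto
  next
    show "\<not> contains_grid r ((`) h ` G)"
    proof
      assume "contains_grid r ((`) h ` G)"
      then have "contains_grid r G" by (rule contains_grid_inj_image[OF _ h(1) G(1) r G(2)])
      then show False using G(4) by simp
    qed
  qed
  have "inj_on ((`) h) G" 
    using h(1) by (intro inj_on_image inj_on_subset[OF h(1)] Union_least G(1))
  then show "card ((`) h ` G) = card G" by (rule card_image)
qed

text \<open>The modulus only has to be coprime to a constant, and \<open>m \<equiv> 1\<close> modulo \<open>K\<close> is a convenient way to ensure this: such
  \<open>m\<close> occur with bounded gaps.\<close>

lemma packing_recursion:
  assumes r: "4 \<le> r"
  obtains K where "0 < K"
    and "\<And>m F. \<lbrakk>[m = 1] (mod K); 4 * r \<le> m; packing r m F\<rbrakk> \<Longrightarrow>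
      \<exists>F'. packing r (r * m) F' \<and> m ^ 2 + r * card F \<le> card F' + bad_constant r * m"
proof -
  show thesis
  proof (rule generic_directions_mod[OF r])
    fix x :: "nat \<Rightarrow> int" and D :: int
    assume D: "D > 0"
    and cop: "\<And>m k l. \<lbrakk>coprime m D; k < r; l < r; k \<noteq> l\<rbrakk> \<Longrightarrow> coprime m (x k - x l)"
    and lat: "\<And>m L a b \<alpha> \<beta>. \<lbrakk>coprime m D; latin_square r L;
        \<And>i j. \<lbrakk>i < r; j < r\<rbrakk> \<Longrightarrow> m dvd (a i * x (L i j) + b i) - (\<alpha> j * x (L i j) + \<beta> j)\<rbrakk>
        \<Longrightarrow> m dvd a 0 - \<alpha> 0 \<and> m dvd b 0 - \<beta> 0"
    show thesis
    proof (rule that[of "nat D"])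
      show "0 < nat D" using D by simp
      fix m F assume m: "[m = 1] (mod (nat D))" "4 * r \<le> m" and F: "packing r m F"
      have "coprime m (nat D)" using cong_imp_coprime[OF cong_sym[OF m(1)]] by simp
      then have "coprime (int m) (int (nat D))" unfolding coprime_int_iff .
      then have cD: "coprime (int m) D" using D by simp
      interpret column_filling r m x F
      proof unfold_locales
        show "4 \<le> r" by fact
        show "0 < m" using m(2) r by simp
        show "coprime (int m) (x k - x l)" if "k < r" "l < r" "k \<noteq> l" for k l using cop[OF cD that] .
        show "int m dvd a 0 - \<alpha> 0 \<and> int m dvd b 0 - \<beta> 0"
          if "latin_square r L" "\<And>i j. \<lbrakk>i < r; j < r\<rbrakk> \<Longrightarrow>
            int m dvd (a i * x (L i j) + b i) - (\<alpha> j * x (L i j) + \<beta> j)" for L a b \<alpha> \<beta>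
          using lat[OF cD that] .
      qed (use F in \<open>auto simp: packing_def linear_hypergraph_def\<close>)
      obtain \<Phi> where few: "\<Phi> \<in> relabellings" "finite (bad \<Phi>)" "card (bad \<Phi>) \<le> bad_constant r * m"
        using few_bad_edges[OF m(2)] .
      interpret relabelled_filling r m x F \<Phi> by unfold_locales (rule few(1))
      define h where "h = (\<lambda>(k, y). k * m + y :: nat)"
      have inj: "inj_on h ({..<r} \<times> {..<m})"
      proof (rule inj_onI)
        fix s t assume st: "s \<in> {..<r} \<times> {..<m}" "t \<in> {..<r} \<times> {..<m}" "h s = h t"
        have "h u div m = fst u \<and> h u mod m = snd u" if "u \<in> {..<r} \<times> {..<m}" for u
          using that m_pos by (cases u) (auto simp: h_def)
        then show "s = t" using st by (metis prod_eqI)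
      qed
      have sub: "h ` ({..<r} \<times> {..<m}) \<subseteq> {..<r * m}"
      proof
        fix v assume "v \<in> h ` ({..<r} \<times> {..<m})"
        then obtain k y where ky: "k < r" "y < m" "v = k * m + y" by (auto simp: h_def)
        have "k * m + y < (k + 1) * m" using ky(2) by simp
        also have "\<dots> \<le> r * m" using ky(1) by (intro mult_le_mono1) simp
        finally show "v \<in> {..<r * m}" using ky(3) by simp
      qed
      have "2 \<le> r" using r by simp
      note img = packing_inj_image[OF inj sub this combined_sub combined_card combined_linear combined_gridfree]
      have "m ^ 2 + r * card F \<le> card ((`) h ` combined \<Phi>) + bad_constant r * m"
        using card_combined[OF few(2)] few(3) img(2) by linarith
      then show "\<exists>F'. packing r (r * m) F' \<and> m ^ 2 + r * card F \<le> card F' + bad_constant r * m"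
        using img(1) by blast
    qed
  qed
qed

text \<open>Write \<open>g n = n (n - 1) / (r (r - 1))\<close>. The identity \<open>g (r m) = m\<^sup>2 + r g m\<close> shows that lines and columns together
  lose nothing in the main term. Rounding \<open>n\<close> down to \<open>r m\<close> and deleting bad edges cost \<open>O(n)\<close>. The accumulated error
  \<open>C n sqrt n\<close> reproduces itself because \<open>r m sqrt m \<le> n sqrt n / 2\<close>.\<close>

lemma packing_bound:
  assumes r: "4 \<le> r"
  obtains C :: real where "0 \<le> C"
    and "\<And>n. \<exists>F. packing r n F \<and>
      real n * (real n - 1) / (real r * (real r - 1)) \<le> real (card F) + C * (real n * sqrt (real n))"
proof -
  obtain K where K: "0 < K"
    and step: "\<And>m F. \<lbrakk>[m = 1] (mod K); 4 * r \<le> m; packing r m F\<rbrakk> \<Longrightarrow>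
      \<exists>F'. packing r (r * m) F' \<and> m ^ 2 + r * card F \<le> card F' + bad_constant r * m"
    using packing_recursion[OF r] by blast
  define g where "g = (\<lambda>n :: nat. real n * (real n - 1) / (real r * (real r - 1)))"
  define N where "N = r * (K + 4 * r)"
  define B where "B = real (bad_constant r)"
  define C where "C = real N + 2 * (B + 2 * (real K + 1))"
  have B0: "0 \<le> B" by (simp add: B_def)
  have C0: "0 \<le> C" "real N \<le> C" "2 * (B + 2 * (real K + 1)) \<le> C" using B0 by (auto simp: C_def)
  have rr: "0 < real r * (real r - 1)" "1 \<le> real r * (real r - 1)" "1 \<le> real r - 1"
  proof -
    show "1 \<le> real r - 1" using r by simp
    then show "0 < real r * (real r - 1)" using r by simp
    have "1 * 1 \<le> real r * (real r - 1)" using r by (intro mult_mono) auto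
    then show "1 \<le> real r * (real r - 1)" by simp
  qed
  have "\<exists>F. packing r n F \<and> g n \<le> real (card F) + C * (real n * sqrt (real n))" for n
  proof (induction n rule: less_induct)
    case (less n)
    show ?case
    proof (cases "n < N")
      case True
      have "packing r n {}"
        using r by (auto simp: packing_def linear_hypergraph_def contains_grid_def)
      moreover have "g n \<le> C * (real n * sqrt (real n))"
      proof (cases "n = 0")
        case False
        have "g n \<le> real n * (real n - 1) / 1"
          unfolding g_def using False rr by (intro divide_left_mono) auto
        also have "\<dots> \<le> C * (real n * 1)"
        proof -
          have "real n - 1 \<le> C" using True C0(2) by simp
          then have "real n * (real n - 1) \<le> real n * C" by (intro mult_left_mono) auto
          then show ?thesis by (simp add: mult.commute)
        qed
        also have "\<dots> \<le> C * (real n * sqrt (real n))"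
          using False C0 by (intro mult_left_mono) auto
        finally show ?thesis .
      qed (simp add: g_def)
      ultimately show ?thesis by force
    next
      case False
      \<comment> \<open>\<open>m\<close> is the largest number congruent to 1 modulo \<open>K\<close> with \<open>r * m \<le> n\<close>.\<close>
      define q where "q = n div r"
      define m where "m = Suc (K * ((q - 1) div K))"
      have rq: "r * q \<le> n" "n < r * q + r"
        using mod_less_divisor[of r n] mult_div_mod_eq[of r n] r unfolding q_def by linarith+
      have "r * (K + 4 * r) < r * (q + 1)" using False rq by (simp add: N_def)
      then have qK: "K + 4 * r \<le> q" using r by (simp only: mult_less_cancel1) simp
      have m_le: "m \<le> q" "q < m + K"
      proof -
        have "q - 1 = K * ((q - 1) div K) + (q - 1) mod K" by simp
        moreover have "(q - 1) mod K < K" using K by simp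
        ultimately show "m \<le> q" "q < m + K" using qK r unfolding m_def by linarith+
      qed
      have m4: "4 * r \<le> m" using m_le qK by linarith
      have cong: "[m = 1] (mod K)" 
        using cong_add_lcancel_0_nat[of 1 "K * ((q - 1) div K)" K] by (simp add: m_def cong_0_iff)
      have rm: "r * m \<le> n" using m_le(1) rq(1) by (meson le_trans mult_le_mono2)
      have gap: "n \<le> r * m + r * (K + 1)"
      proof -
        have "r * q \<le> r * (m + K)" using m_le by (intro mult_le_mono2) simp
        then show ?thesis using rq by (simp add: algebra_simps)
      qed
      have m0: "0 < m" using m4 r by linarith
      have "m < r * m" using r m0 by simp
      then have "m < n" using rm by linarith
      from less[OF this] obtain F where F: "packing r m F" "g m \<le> real (card F) + C * (real m * sqrt (real m))"
        by blast
      from step[OF cong m4 F(1)] obtain F' where F': "packing r (r * m) F'"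
        "m ^ 2 + r * card F \<le> card F' + bad_constant r * m" by blast
      have cF': "real m ^ 2 + real r * real (card F) \<le> real (card F') + B * real m"
        using F'(2) unfolding B_def of_nat_mult[symmetric] of_nat_power[symmetric] of_nat_add[symmetric] of_nat_le_iff .
      have rmn: "real r * real m \<le> real n" using rm by (metis of_nat_le_iff of_nat_mult)
      have gapn: "real n \<le> real r * real m + real r * (real K + 1)"
      proof -
        have "real n \<le> real (r * m + r * (K + 1))" using gap by (simp only: of_nat_le_iff)
        then show ?thesis by (simp add: algebra_simps)
      qed
      have n1: "1 \<le> real n" using \<open>m < n\<close> by simp
      have "real n * (real n - 1) - (real r * real m) * (real r * real m - 1)
          = (real n - real r * real m) * (real n + real r * real m - 1)" by (simp add: algebra_simps)
      also have "\<dots> \<le> (real r * (real K + 1)) * (2 * real n)"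
      proof (intro mult_mono)
        have "0 \<le> real r * real m" by simp
        then show "0 \<le> real n + real r * real m - 1" using n1 by linarith
        show "real n + real r * real m - 1 \<le> 2 * real n" using rmn by linarith
        show "real n - real r * real m \<le> real r * (real K + 1)" using gapn by linarith
      qed simp
      finally have d1: "real n * (real n - 1) \<le>
          (real r * real m) * (real r * real m - 1) + (real r * (real K + 1)) * (2 * real n)" by simp
      have "g n \<le> ((real r * real m) * (real r * real m - 1) + (real r * (real K + 1)) * (2 * real n)) / (real r * (real r - 1))"
        unfolding g_def using d1 rr by (intro divide_right_mono) auto
      also have "\<dots> = (real r * real m) * (real r * real m - 1) / (real r * (real r - 1))
          + (real r * (real K + 1)) * (2 * real n) / (real r * (real r - 1))" by (rule add_divide_distrib)
      also have "(real r * real m) * (real r * real m - 1) / (real r * (real r - 1)) = real m ^ 2 + real r * g m"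
        using rr r unfolding g_def by (simp add: field_simps power2_eq_square)
      also have "(real r * (real K + 1)) * (2 * real n) / (real r * (real r - 1)) = (2 * (real K + 1) * real n) / (real r - 1)"
        using r by simp
      also have "\<dots> \<le> 2 * (real K + 1) * real n / 1"
        using rr by (intro divide_left_mono) auto
      finally have g1: "g n \<le> real m ^ 2 + real r * g m + 2 * (real K + 1) * real n" by simp
      have "real r * g m \<le> real r * (real (card F) + C * (real m * sqrt (real m)))"
        using F(2) by (intro mult_left_mono) auto
      then have g2: "g n \<le> real (card F') + B * real m + C * ((real r * real m) * sqrt (real m)) + 2 * (real K + 1) * real n"
        using g1 cF' by (simp add: algebra_simps)
      have sq: "sqrt (real m) \<le> sqrt (real n) / 2"
      proof -
        have "4 * real m \<le> real r * real m" using r by (intro mult_right_mono) auto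
        then have "real m \<le> real n / 4" using rmn by simp
        then have "sqrt (real m) \<le> sqrt (real n / 4)" by simp
        then show ?thesis by (simp add: real_sqrt_divide)
      qed
      have "(real r * real m) * sqrt (real m) \<le> real n * (sqrt (real n) / 2)"
        using rmn sq by (intro mult_mono) auto
      then have "C * ((real r * real m) * sqrt (real m)) \<le> C * (real n * (sqrt (real n) / 2))"
        using C0 by (intro mult_left_mono)
      then have t1: "C * ((real r * real m) * sqrt (real m)) \<le> (C / 2) * (real n * sqrt (real n))" by simp
      have "B * real m \<le> B * real n" using \<open>m < n\<close> B0 by (intro mult_left_mono) auto
      then have "B * real m + 2 * (real K + 1) * real n \<le> (B + 2 * (real K + 1)) * real n"
        by (simp add: algebra_simps)
      also have "\<dots> \<le> (C / 2) * (real n * sqrt (real n))"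
        using C0 B0 n1 by (intro mult_mono) auto
      finally have t2: "B * real m + 2 * (real K + 1) * real n \<le> (C / 2) * (real n * sqrt (real n))" .
      have "g n \<le> real (card F') + C * (real n * sqrt (real n))" using g2 t1 t2 by (simp add: algebra_simps)
      then show ?thesis using packing_mono[OF F'(1) rm] by blast
    qed
  qed
  then show thesis using that[OF C0(1)] unfolding g_def by blast
qed

theorem theorem1p2:
  shows "\<forall>r::nat. r \<ge> 4 \<longrightarrow>
    (\<exists>c::real. c > 0 \<and>
      (\<forall>n::nat. n \<ge> 4 \<longrightarrow>
        (\<exists>(V :: nat set) (F :: nat set set).
          hypergraph_on V F \<and> card V = n \<and>
          uniform_hypergraph r F \<and> linear_hypergraph F \<and> \<not> contains_grid r F \<and>
          real (card F) > real n * (real n - 1) / (real r * (real r - 1))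
                            - c * real n powr (8 / 5))))"
proof (intro allI impI)
  fix r :: nat assume r: "r \<ge> 4"
  obtain C :: real where C: "0 \<le> C" "\<And>n. \<exists>F. packing r n F \<and>
      real n * (real n - 1) / (real r * (real r - 1)) \<le> real (card F) + C * (real n * sqrt (real n))"
    using packing_bound[OF r] by blast
  show "\<exists>c::real. c > 0 \<and> (\<forall>n::nat. n \<ge> 4 \<longrightarrow>
        (\<exists>(V :: nat set) (F :: nat set set). hypergraph_on V F \<and> card V = n \<and>
          uniform_hypergraph r F \<and> linear_hypergraph F \<and> \<not> contains_grid r F \<and>
          real (card F) > real n * (real n - 1) / (real r * (real r - 1)) - c * real n powr (8 / 5)))"
  proof (intro exI[of _ "C + 1"] conjI allI impI)
    show "C + 1 > 0" using C(1) by simp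
    fix n :: nat assume n: "n \<ge> 4"
    obtain F where F: "packing r n F"
      "real n * (real n - 1) / (real r * (real r - 1)) \<le> real (card F) + C * (real n * sqrt (real n))"
      using C(2) by blast
    have "real n * sqrt (real n) = real n powr 1 * real n powr (1 / 2)"
      by (simp add: powr_half_sqrt)
    also have "\<dots> = real n powr (3 / 2)" unfolding powr_add[symmetric] by simp
    also have "\<dots> \<le> real n powr (8 / 5)" using n by (intro powr_mono) auto
    finally have "C * (real n * sqrt (real n)) \<le> C * real n powr (8 / 5)"
      using C(1) by (intro mult_left_mono)
    moreover have "0 < real n powr (8 / 5)" using n by simp
    moreover have "(C + 1) * real n powr (8 / 5) = C * real n powr (8 / 5) + real n powr (8 / 5)"
      by (simp add: algebra_simps)
    ultimately have "real n * (real n - 1) / (real r * (real r - 1)) - (C + 1) * real n powr (8 / 5) < real (card F)"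
      using F(2) by linarith
    moreover have "hypergraph_on {..<n} F" "uniform_hypergraph r F" "linear_hypergraph F" "\<not> contains_grid r F"
      using F(1) finite_subset[of _ "{..<n}"]
      by (auto simp: packing_def hypergraph_on_def uniform_hypergraph_def)
    ultimately show "\<exists>(V :: nat set) (F :: nat set set). hypergraph_on V F \<and> card V = n \<and>
          uniform_hypergraph r F \<and> linear_hypergraph F \<and> \<not> contains_grid r F \<and>
          real (card F) > real n * (real n - 1) / (real r * (real r - 1)) - (C + 1) * real n powr (8 / 5)"
      by (intro exI[of _ "{..<n}"] exI[of _ F]) simp
  qed
qed

end
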